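(* Let $(M,J,g)$ be an almost Hermitian manifold and fix a local unitary $(1,0)$-frame. Then for all $i,j,k,l\in\{1,\dots,n\}$ $$\begin{aligned}R^L_{ijk\bar l}=&\frac12\left(R_{k\bar l ij}-R_{i\bar l jk}-R_{j\bar l ki}\right)+\frac12\left(\tau_{ij;k}^l-\tau_{ij}^{\bar\lambda}\tau_{\bar l\bar\lambda}^{\bar k}\right)+\frac14\left(\tau_{j\lambda}^l\tau_{ik}^\lambda-\tau_{i\lambda}^l\tau_{jk}^\lambda\right)\\&+\frac14\tau_{\bar l\bar\lambda}^{\bar i}\left(\tau_{jk}^{\bar\lambda}-\tau_{k\lambda}^{\bar j}+\tau_{\lambda j}^{\bar k}\right)-\frac14\tau_{\bar l\bar\lambda}^{\bar j}\left(\tau_{ik}^{\bar\lambda}-\tau_{k\lambda}^{\bar i}+\tau_{\lambda i}^{\bar k}\right).\end{aligned}$$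
   Context: An almost Hermitian manifold $(M,J,g)$ is a manifold $M$ of real dimension $2n$ with an almost complex structure $J$ and a Riemannian metric $g$ satisfying $g(JX,JY)=g(X,Y)$. Write $\langle\cdot,\cdot\rangle$ for the complex bilinear extension of $g$ to $TM\otimes\mathbb C$. The torsion of a connection $\nabla$ is $\tau(X,Y)=\nabla_XY-\nabla_YX-[X,Y]$. The canonical connection $\nabla$ is the unique connection with $\nabla g=0$, $\nabla J=0$ and $\tau(X,\overline Y)=0$ for all $(1,0)$-vectors $X,Y$ (tensors and connections are extended complex linearly); $\tau$ denotes its torsion and $R$ its curvature tensor, with $R(X,Y)Z=\nabla_X\nabla_YZ-\nabla_Y\nabla_XZ-\nabla_{[X,Y]}Z$ and $R(X,Y,Z,W)=\langle R(Z,W)X,Y\rangle$. $R^L$ denotes the curvature tensor of the Levi-Civita connection, with the same conventions. A local unitary $(1,0)$-frame $(e_1,\dots,e_n)$ is a local frame of $T^{1,0}M$ with $\langle e_i,\overline{e_j}\rangle=\delta_{ij}$; $e_{\bar i}=\overline{e_i}$. For $A,B,C,D\in\{1,\bar1,\dots,n,\bar n\}$: $R_{ABCD}=R(e_A,e_B,e_C,e_D)$, $R^L_{ABCD}=R^L(e_A,e_B,e_C,e_D)$, $\tau(e_A,e_B)=\sum_C\tau_{AB}^Ce_C$, and ";" denotes covariant derivatives with respect to $\nabla$: $(\nabla_{e_C}\tau)(e_A,e_B)=\sum_D\tau_{AB;C}^De_D$. A Greek index $\lambda$ occurring in a product is summed over $1,\dots,n$. *)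

theory Defs
  imports "HOL-Analysis.Analysis"
begin

section \<open>Smooth manifolds\<close>

text \<open>Only used for open \<open>S\<close>, where all directional derivatives of order at most \<open>k\<close>
  existing and being continuous is the usual class \<open>C^k\<close>.\<close>

primrec Ck_on :: "nat \<Rightarrow> 'e::euclidean_space set \<Rightarrow> ('e \<Rightarrow> 'b::real_normed_vector) \<Rightarrow> bool" where
  "Ck_on 0 S f \<longleftrightarrow> continuous_on S f"
| "Ck_on (Suc k) S f \<longleftrightarrow> (\<forall>x\<in>S. f differentiable (at x)) \<and>
     (\<forall>v. Ck_on k S (\<lambda>x. frechet_derivative f (at x) v))"

definition Cinf_on :: "'e::euclidean_space set \<Rightarrow> ('e \<Rightarrow> 'b::real_normed_vector) \<Rightarrow> bool" where
  "Cinf_on S f \<longleftrightarrow> (\<forall>k. Ck_on k S f)"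

text \<open>A manifold is represented by a (not necessarily maximal) smooth atlas, a set of pairs of a
  chart domain and a chart map. Its underlying set is the union of the chart domains, an open
  subset of the ambient topological type, with the subspace topology. Hausdorffness and second
  countability come from the type class of the ambient type.\<close>

type_synonym ('a, 'e) atlas = "('a set \<times> ('a \<Rightarrow> 'e)) set"

definition points :: "('a, 'e) atlas \<Rightarrow> 'a set" where
  "points M = \<Union> (fst ` M)"

definition smooth_atlas ::
  "('a::{t2_space, second_countable_topology}, 'e::euclidean_space) atlas \<Rightarrow> bool" where
  "smooth_atlas M \<longleftrightarrow>
     (\<forall>(U, \<phi>)\<in>M. open U \<and> open (\<phi> ` U) \<and> homeomorphism U (\<phi> ` U) \<phi> (inv_into U \<phi>)) \<and>
     (\<forall>(U, \<phi>)\<in>M. \<forall>(V, \<psi>)\<in>M. Cinf_on (\<phi> ` (U \<inter> V)) (\<psi> \<circ> inv_into U \<phi>))"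

definition smooth_fun ::
  "('a::topological_space, 'e::euclidean_space) atlas \<Rightarrow> 'a set \<Rightarrow> ('a \<Rightarrow> real) \<Rightarrow> bool" where
  "smooth_fun M V f \<longleftrightarrow> open V \<and> V \<subseteq> points M \<and>
     (\<forall>(U, \<phi>)\<in>M. Cinf_on (\<phi> ` (U \<inter> V)) (f \<circ> inv_into U \<phi>))"

definition smooth_near ::
  "('a::topological_space, 'e::euclidean_space) atlas \<Rightarrow> 'a \<Rightarrow> ('a \<Rightarrow> real) \<Rightarrow> bool" where
  "smooth_near M p f \<longleftrightarrow> (\<exists>V. p \<in> V \<and> smooth_fun M V f)"


section \<open>Tangent vectors and vector fields\<close>

text \<open>Tangent vectors at \<open>p\<close> are the derivations of the algebra of germs at \<open>p\<close> of smooth real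
  functions. They are represented by maps on all functions, made extensional by the value \<open>0\<close> on
  functions that are not smooth near \<open>p\<close>. With values in \<open>complex\<close> the same type carries the
  complexified tangent vectors: \<open>v + \<i> w\<close> is the map sending \<open>f\<close> to \<open>v f + \<i> * w f\<close>.\<close>

type_synonym ('a, 'k) tvec = "('a \<Rightarrow> real) \<Rightarrow> 'k"
type_synonym ('a, 'k) vfield = "'a \<Rightarrow> ('a, 'k) tvec"

definition tangent_space ::
  "('a::topological_space, 'e::euclidean_space) atlas \<Rightarrow> 'a \<Rightarrow> ('a, real) tvec set" where
  "tangent_space M p = {v.
     (\<forall>f g. smooth_near M p f \<longrightarrow> smooth_near M p g \<longrightarrow>
        v (\<lambda>q. f q + g q) = v f + v g \<and>
        v (\<lambda>q. f q * g q) = v f * g p + f p * v g) \<and>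
     (\<forall>c f. smooth_near M p f \<longrightarrow> v (\<lambda>q. c * f q) = c * v f) \<and>
     (\<forall>f g. smooth_near M p f \<longrightarrow> (\<forall>\<^sub>F q in nhds p. f q = g q) \<longrightarrow> v f = v g) \<and>
     (\<forall>f. \<not> smooth_near M p f \<longrightarrow> v f = 0)}"

text \<open>Fields over an open set \<open>U\<close> are total functions whose values outside \<open>U\<close> are irrelevant.\<close>

definition smooth_vfield ::
  "('a::topological_space, 'e::euclidean_space) atlas \<Rightarrow> 'a set \<Rightarrow> ('a, real) vfield \<Rightarrow> bool" where
  "smooth_vfield M U X \<longleftrightarrow> open U \<and> U \<subseteq> points M \<and>
     (\<forall>p\<in>U. X p \<in> tangent_space M p) \<and>
     (\<forall>V f. V \<subseteq> U \<longrightarrow> smooth_fun M V f \<longrightarrow> smooth_fun M V (\<lambda>p. X p f))"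

definition lie_bracket ::
  "('a::topological_space, 'e::euclidean_space) atlas \<Rightarrow>
   ('a, real) vfield \<Rightarrow> ('a, real) vfield \<Rightarrow> ('a, real) vfield" where
  "lie_bracket M X Y = (\<lambda>p f. if smooth_near M p f
     then X p (\<lambda>q. Y q f) - Y p (\<lambda>q. X q f) else 0)"


section \<open>Almost Hermitian structures\<close>

definition riemannian_metric ::
  "('a::topological_space, 'e::euclidean_space) atlas \<Rightarrow>
   ('a \<Rightarrow> ('a, real) tvec \<Rightarrow> ('a, real) tvec \<Rightarrow> real) \<Rightarrow> bool" where
  "riemannian_metric M g \<longleftrightarrow>
     (\<forall>p\<in>points M. \<forall>u\<in>tangent_space M p. \<forall>v\<in>tangent_space M p.
        g p u v = g p v u \<and>
        (\<forall>w\<in>tangent_space M p. \<forall>a b. g p (\<lambda>f. a * u f + b * v f) w = a * g p u w + b * g p v w)) \<and>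
     (\<forall>p\<in>points M. \<forall>u\<in>tangent_space M p. u \<noteq> (\<lambda>f. 0) \<longrightarrow> g p u u > 0) \<and>
     (\<forall>U X Y. smooth_vfield M U X \<longrightarrow> smooth_vfield M U Y \<longrightarrow>
        smooth_fun M U (\<lambda>p. g p (X p) (Y p)))"

definition almost_complex_structure ::
  "('a::topological_space, 'e::euclidean_space) atlas \<Rightarrow>
   ('a \<Rightarrow> ('a, real) tvec \<Rightarrow> ('a, real) tvec) \<Rightarrow> bool" where
  "almost_complex_structure M J \<longleftrightarrow>
     (\<forall>p\<in>points M. \<forall>u\<in>tangent_space M p.
        J p u \<in> tangent_space M p \<and> J p (J p u) = (\<lambda>f. - u f) \<and>
        (\<forall>v\<in>tangent_space M p. \<forall>a b.
           J p (\<lambda>f. a * u f + b * v f) = (\<lambda>f. a * J p u f + b * J p v f))) \<and>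
     (\<forall>U X. smooth_vfield M U X \<longrightarrow> smooth_vfield M U (\<lambda>p. J p (X p)))"

definition almost_hermitian_manifold ::
  "nat \<Rightarrow> ('a::{t2_space, second_countable_topology}, 'e::euclidean_space) atlas \<Rightarrow>
   ('a \<Rightarrow> ('a, real) tvec \<Rightarrow> ('a, real) tvec) \<Rightarrow>
   ('a \<Rightarrow> ('a, real) tvec \<Rightarrow> ('a, real) tvec \<Rightarrow> real) \<Rightarrow> bool" where
  "almost_hermitian_manifold n M J g \<longleftrightarrow>
     smooth_atlas M \<and> DIM('e) = 2 * n \<and>
     almost_complex_structure M J \<and> riemannian_metric M g \<and>
     (\<forall>p\<in>points M. \<forall>u\<in>tangent_space M p. \<forall>v\<in>tangent_space M p.
        g p (J p u) (J p v) = g p u v)"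


section \<open>Connections\<close>

text \<open>\<open>D p v Y\<close> is the derivative of the field \<open>Y\<close>, given near \<open>p\<close>, in the direction of the tangent
  vector \<open>v\<close> at \<open>p\<close>. A connection is thus given by its action on local vector fields; the last but
  one conjunct says that only the germ of \<open>Y\<close> at \<open>p\<close> matters.\<close>

type_synonym 'a connection = "'a \<Rightarrow> ('a, real) tvec \<Rightarrow> ('a, real) vfield \<Rightarrow> ('a, real) tvec"

definition connection ::
  "('a::topological_space, 'e::euclidean_space) atlas \<Rightarrow> 'a connection \<Rightarrow> bool" where
  "connection M D \<longleftrightarrow>
     (\<forall>U Y. smooth_vfield M U Y \<longrightarrow>
        (\<forall>p\<in>U. \<forall>v\<in>tangent_space M p.
           D p v Y \<in> tangent_space M p \<and>
           (\<forall>w\<in>tangent_space M p. \<forall>a b.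
              D p (\<lambda>f. a * v f + b * w f) Y = (\<lambda>f. a * D p v Y f + b * D p w Y f)) \<and>
           (\<forall>Z. smooth_vfield M U Z \<longrightarrow>
              D p v (\<lambda>q f. Y q f + Z q f) = (\<lambda>f. D p v Y f + D p v Z f)) \<and>
           (\<forall>h. smooth_fun M U h \<longrightarrow>
              D p v (\<lambda>q f. h q * Y q f) = (\<lambda>f. v h * Y p f + h p * D p v Y f)) \<and>
           (\<forall>Z. (\<forall>q\<in>U. Y q = Z q) \<longrightarrow> D p v Y = D p v Z)) \<and>
        (\<forall>X. smooth_vfield M U X \<longrightarrow> smooth_vfield M U (\<lambda>p. D p (X p) Y)))"

definition cov :: "'a connection \<Rightarrow> ('a, real) vfield \<Rightarrow> ('a, real) vfield \<Rightarrow> ('a, real) vfield" where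
  "cov D X Y = (\<lambda>p. D p (X p) Y)"

definition metric_connection ::
  "('a::topological_space, 'e::euclidean_space) atlas \<Rightarrow>
   ('a \<Rightarrow> ('a, real) tvec \<Rightarrow> ('a, real) tvec \<Rightarrow> real) \<Rightarrow> 'a connection \<Rightarrow> bool" where
  "metric_connection M g D \<longleftrightarrow>
     (\<forall>U X Y Z. smooth_vfield M U X \<longrightarrow> smooth_vfield M U Y \<longrightarrow> smooth_vfield M U Z \<longrightarrow>
        (\<forall>p\<in>U. X p (\<lambda>q. g q (Y q) (Z q)) = g p (cov D X Y p) (Z p) + g p (Y p) (cov D X Z p)))"

definition complex_connection ::
  "('a::topological_space, 'e::euclidean_space) atlas \<Rightarrow>
   ('a \<Rightarrow> ('a, real) tvec \<Rightarrow> ('a, real) tvec) \<Rightarrow> 'a connection \<Rightarrow> bool" where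
  "complex_connection M J D \<longleftrightarrow>
     (\<forall>U X Y. smooth_vfield M U X \<longrightarrow> smooth_vfield M U Y \<longrightarrow>
        (\<forall>p\<in>U. cov D X (\<lambda>q. J q (Y q)) p = J p (cov D X Y p)))"

text \<open>Torsion, curvature and covariant derivative of the torsion, for an operation \<open>N\<close>
  (covariant derivative) and an operation \<open>B\<close> (Lie bracket) on real or on complex vector fields.\<close>

definition torsion ::
  "(('a, 'k::ab_group_add) vfield \<Rightarrow> ('a, 'k) vfield \<Rightarrow> ('a, 'k) vfield) \<Rightarrow>
   (('a, 'k) vfield \<Rightarrow> ('a, 'k) vfield \<Rightarrow> ('a, 'k) vfield) \<Rightarrow>
   ('a, 'k) vfield \<Rightarrow> ('a, 'k) vfield \<Rightarrow> ('a, 'k) vfield" where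
  "torsion N B X Y = (\<lambda>p f. N X Y p f - N Y X p f - B X Y p f)"

definition curvature ::
  "(('a, 'k::ab_group_add) vfield \<Rightarrow> ('a, 'k) vfield \<Rightarrow> ('a, 'k) vfield) \<Rightarrow>
   (('a, 'k) vfield \<Rightarrow> ('a, 'k) vfield \<Rightarrow> ('a, 'k) vfield) \<Rightarrow>
   ('a, 'k) vfield \<Rightarrow> ('a, 'k) vfield \<Rightarrow> ('a, 'k) vfield \<Rightarrow> ('a, 'k) vfield" where
  "curvature N B X Y Z = (\<lambda>p f. N X (N Y Z) p f - N Y (N X Z) p f - N (B X Y) Z p f)"

text \<open>\<open>cov_torsion N B Z X Y\<close> is the value on \<open>X, Y\<close> of the derivative of the torsion along \<open>Z\<close>.\<close>

definition cov_torsion ::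
  "(('a, 'k::ab_group_add) vfield \<Rightarrow> ('a, 'k) vfield \<Rightarrow> ('a, 'k) vfield) \<Rightarrow>
   (('a, 'k) vfield \<Rightarrow> ('a, 'k) vfield \<Rightarrow> ('a, 'k) vfield) \<Rightarrow>
   ('a, 'k) vfield \<Rightarrow> ('a, 'k) vfield \<Rightarrow> ('a, 'k) vfield \<Rightarrow> ('a, 'k) vfield" where
  "cov_torsion N B Z X Y = (\<lambda>p f. N Z (torsion N B X Y) p f
     - torsion N B (N Z X) Y p f - torsion N B X (N Z Y) p f)"

definition levi_civita_connection ::
  "('a::topological_space, 'e::euclidean_space) atlas \<Rightarrow>
   ('a \<Rightarrow> ('a, real) tvec \<Rightarrow> ('a, real) tvec \<Rightarrow> real) \<Rightarrow> 'a connection \<Rightarrow> bool" where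
  "levi_civita_connection M g D \<longleftrightarrow> connection M D \<and> metric_connection M g D \<and>
     (\<forall>U X Y. smooth_vfield M U X \<longrightarrow> smooth_vfield M U Y \<longrightarrow>
        (\<forall>p\<in>U. torsion (cov D) (lie_bracket M) X Y p = (\<lambda>f. 0)))"


section \<open>Complexification\<close>

definition re_vec :: "('a, complex) tvec \<Rightarrow> ('a, real) tvec" where
  "re_vec v = (\<lambda>f. Re (v f))"

definition im_vec :: "('a, complex) tvec \<Rightarrow> ('a, real) tvec" where
  "im_vec v = (\<lambda>f. Im (v f))"

definition ctangent_space ::
  "('a::topological_space, 'e::euclidean_space) atlas \<Rightarrow> 'a \<Rightarrow> ('a, complex) tvec set" where
  "ctangent_space M p = {v. re_vec v \<in> tangent_space M p \<and> im_vec v \<in> tangent_space M p}"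

definition smooth_cvfield ::
  "('a::topological_space, 'e::euclidean_space) atlas \<Rightarrow> 'a set \<Rightarrow> ('a, complex) vfield \<Rightarrow> bool" where
  "smooth_cvfield M U Z \<longleftrightarrow>
     smooth_vfield M U (\<lambda>p. re_vec (Z p)) \<and> smooth_vfield M U (\<lambda>p. im_vec (Z p))"

definition conj_field :: "('a, complex) vfield \<Rightarrow> ('a, complex) vfield" where
  "conj_field Z = (\<lambda>p f. cnj (Z p f))"

definition cext_J ::
  "('a \<Rightarrow> ('a, real) tvec \<Rightarrow> ('a, real) tvec) \<Rightarrow>
   'a \<Rightarrow> ('a, complex) tvec \<Rightarrow> ('a, complex) tvec" where
  "cext_J J p v = (\<lambda>f. Complex (J p (re_vec v) f) (J p (im_vec v) f))"

definition cext_metric ::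
  "('a \<Rightarrow> ('a, real) tvec \<Rightarrow> ('a, real) tvec \<Rightarrow> real) \<Rightarrow>
   'a \<Rightarrow> ('a, complex) tvec \<Rightarrow> ('a, complex) tvec \<Rightarrow> complex" where
  "cext_metric g p v w = Complex
     (g p (re_vec v) (re_vec w) - g p (im_vec v) (im_vec w))
     (g p (re_vec v) (im_vec w) + g p (im_vec v) (re_vec w))"

definition cext ::
  "(('a, real) vfield \<Rightarrow> ('a, real) vfield \<Rightarrow> ('a, real) vfield) \<Rightarrow>
   ('a, complex) vfield \<Rightarrow> ('a, complex) vfield \<Rightarrow> ('a, complex) vfield" where
  "cext N Z W = (let X = (\<lambda>p. re_vec (Z p)); X' = (\<lambda>p. im_vec (Z p));
                     Y = (\<lambda>p. re_vec (W p)); Y' = (\<lambda>p. im_vec (W p))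
     in (\<lambda>p f. Complex (N X Y p f - N X' Y' p f) (N X Y' p f + N X' Y p f)))"

abbreviation ctorsion where
  "ctorsion M D \<equiv> torsion (cext (cov D)) (cext (lie_bracket M))"

abbreviation ccurvature where
  "ccurvature M D \<equiv> curvature (cext (cov D)) (cext (lie_bracket M))"

abbreviation ccov_torsion where
  "ccov_torsion M D \<equiv> cov_torsion (cext (cov D)) (cext (lie_bracket M))"

definition curvature4 ::
  "('a::topological_space, 'e::euclidean_space) atlas \<Rightarrow>
   ('a \<Rightarrow> ('a, real) tvec \<Rightarrow> ('a, real) tvec \<Rightarrow> real) \<Rightarrow> 'a connection \<Rightarrow>
   ('a, complex) vfield \<Rightarrow> ('a, complex) vfield \<Rightarrow> ('a, complex) vfield \<Rightarrow> ('a, complex) vfield \<Rightarrow>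
   'a \<Rightarrow> complex" where
  "curvature4 M g D X Y Z W p = cext_metric g p (ccurvature M D Z W X p) (Y p)"

definition T10 ::
  "('a::topological_space, 'e::euclidean_space) atlas \<Rightarrow>
   ('a \<Rightarrow> ('a, real) tvec \<Rightarrow> ('a, real) tvec) \<Rightarrow> 'a \<Rightarrow> ('a, complex) tvec set" where
  "T10 M J p = {v \<in> ctangent_space M p. cext_J J p v = (\<lambda>f. \<i> * v f)}"

definition smooth_10_field ::
  "('a::topological_space, 'e::euclidean_space) atlas \<Rightarrow>
   ('a \<Rightarrow> ('a, real) tvec \<Rightarrow> ('a, real) tvec) \<Rightarrow> 'a set \<Rightarrow> ('a, complex) vfield \<Rightarrow> bool" where
  "smooth_10_field M J U Z \<longleftrightarrow> smooth_cvfield M U Z \<and> (\<forall>p\<in>U. Z p \<in> T10 M J p)"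

definition canonical_connection ::
  "('a::topological_space, 'e::euclidean_space) atlas \<Rightarrow>
   ('a \<Rightarrow> ('a, real) tvec \<Rightarrow> ('a, real) tvec) \<Rightarrow>
   ('a \<Rightarrow> ('a, real) tvec \<Rightarrow> ('a, real) tvec \<Rightarrow> real) \<Rightarrow> 'a connection \<Rightarrow> bool" where
  "canonical_connection M J g D \<longleftrightarrow>
     connection M D \<and> metric_connection M g D \<and> complex_connection M J D \<and>
     (\<forall>U X Y. smooth_10_field M J U X \<longrightarrow> smooth_10_field M J U Y \<longrightarrow>
        (\<forall>p\<in>U. ctorsion M D X (conj_field Y) p = (\<lambda>f. 0)))"


section \<open>Unitary frames and components\<close>

definition unitary_10_frame ::
  "nat \<Rightarrow> ('a::topological_space, 'e::euclidean_space) atlas \<Rightarrow>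
   ('a \<Rightarrow> ('a, real) tvec \<Rightarrow> ('a, real) tvec) \<Rightarrow>
   ('a \<Rightarrow> ('a, real) tvec \<Rightarrow> ('a, real) tvec \<Rightarrow> real) \<Rightarrow>
   'a set \<Rightarrow> (nat \<Rightarrow> ('a, complex) vfield) \<Rightarrow> bool" where
  "unitary_10_frame n M J g U e \<longleftrightarrow> open U \<and> U \<subseteq> points M \<and>
     (\<forall>i\<in>{1..n}. smooth_10_field M J U (e i)) \<and>
     (\<forall>p\<in>U. \<forall>v\<in>T10 M J p. \<exists>c. v = (\<lambda>f. \<Sum>i=1..n. c i * e i p f)) \<and>
     (\<forall>p\<in>U. \<forall>c. (\<lambda>f. \<Sum>i=1..n. c i * e i p f) = (\<lambda>f. 0) \<longrightarrow> (\<forall>i\<in>{1..n}. c i = 0)) \<and>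
     (\<forall>p\<in>U. \<forall>i\<in>{1..n}. \<forall>j\<in>{1..n}.
        cext_metric g p (e i p) (conj_field (e j) p) = (if i = j then 1 else 0))"

datatype frame_index = Hol nat | Bar nat

definition frame_indices :: "nat \<Rightarrow> frame_index set" where
  "frame_indices n = Hol ` {1..n} \<union> Bar ` {1..n}"

fun frame_field :: "(nat \<Rightarrow> ('a, complex) vfield) \<Rightarrow> frame_index \<Rightarrow> ('a, complex) vfield" where
  "frame_field e (Hol i) = e i"
| "frame_field e (Bar i) = conj_field (e i)"

text \<open>The requirement that \<open>c\<close> vanish outside the index set makes it unique as a total function.\<close>

definition component ::
  "nat \<Rightarrow> (nat \<Rightarrow> ('a, complex) vfield) \<Rightarrow> 'a \<Rightarrow> ('a, complex) tvec \<Rightarrow> frame_index \<Rightarrow> complex" where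
  "component n e p v = (THE c. (\<forall>A. A \<notin> frame_indices n \<longrightarrow> c A = 0) \<and>
     v = (\<lambda>f. \<Sum>A\<in>frame_indices n. c A * frame_field e A p f))"

definition curvature_comp where
  "curvature_comp M g D e p A B C E = curvature4 M g D
     (frame_field e A) (frame_field e B) (frame_field e C) (frame_field e E) p"

text \<open>The last index is the upper one: \<open>torsion_comp \<dots> A B C\<close> is the coefficient of \<open>e\<^sub>C\<close>.\<close>

definition torsion_comp where
  "torsion_comp n M D e p A B C =
     component n e p (ctorsion M D (frame_field e A) (frame_field e B) p) C"

text \<open>\<open>cov_torsion_comp \<dots> A B C E\<close> has \<open>C\<close> as the index of differentiation and \<open>E\<close> as the
  upper index.\<close>

definition cov_torsion_comp where
  "cov_torsion_comp n M D e p A B C E = component n e p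
     (ccov_torsion M D (frame_field e C) (frame_field e A) (frame_field e B) p) E"

end

theory Submission
  imports Defs "HOL-Library.Function_Algebras"
begin

text \<open>Let \<open>A = \<nabla>\<^sup>L - \<nabla>\<close>. Both connections are metric and \<open>\<nabla>\<^sup>L\<close> is torsion-free, so \<open>A\<close> is skew and the
  Koszul formula expresses \<open>2\<langle>A(X,Y),Z\<rangle>\<close> by the torsion of \<open>\<nabla>\<close>. Expanding \<open>\<nabla>\<^sup>L = \<nabla> + A\<close> in the
  curvature gives \<open>R\<^sup>L(Z,W)X = R(Z,W)X + (\<nabla>\<^sub>Z A)(W,X) - (\<nabla>\<^sub>W A)(Z,X) + A(\<tau>(Z,W),X) + [A\<^sub>Z,A\<^sub>W]X\<close>. For
  \<open>X, Y, Z\<close> of type (1,0) and \<open>W\<close> of type (0,1) the terms with \<open>R\<close> and \<open>\<tau>(Z,W)\<close> vanish because \<open>\<nabla>\<close>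
  preserves types. The derivative of \<open>\<tau>\<close> in the (0,1) direction is eliminated by the first Bianchi
  identity, which produces the curvature terms and one quadratic torsion term; the commutator of
  \<open>A\<close>, expanded in the frame, yields the other quadratic terms.\<close>

text \<open>Three obstacles shape the proof. First, fields are total functions but their identities
  hold only on \<open>U\<close>. All operations are therefore cut off to 0 outside \<open>U\<close>
  and compared with the given ones point by point in \<open>U\<close>. Second, the frame is complex
  while connections act on real fields. The algebra uses additive axioms in abelian groups only, so
  one development serves real fields and their complexification. An abelian group has no halving, so
  the identities for A (named \<open>contor\<close>) are stated doubled. A is half a signed sum of
  torsions, hence products of two A carry 1/4. Third, quadratic terms must be expanded in the frame.
  Skewness of A first makes them metric products of two fields, where Parseval's formula suffices;
  only the iterated torsion from the Bianchi identity needs linearity of the torsion in a slot.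
  Types keep the result short: (1,0)-fields are isotropic and \<nabla> preserves them, so the
  Bianchi identity for two (1,0)-fields and one (0,1)-field, paired with a (1,0)-field, retains one
  derivative of the torsion, one curvature term and one iterated torsion.\<close>

section \<open>Algebra of two metric connections\<close>

text \<open>The second connection \<open>L\<close> is torsion-free, so the Lie bracket is \<open>L X Y - L Y X\<close> and needs no
  parameter of its own.\<close>

locale two_metric_connections =
  fixes S :: "'v::ab_group_add set" and F :: "'c::ab_group_add set"
    and N L :: "'v \<Rightarrow> 'v \<Rightarrow> 'v" and G :: "'v \<Rightarrow> 'v \<Rightarrow> 'c" and d :: "'v \<Rightarrow> 'c \<Rightarrow> 'c"
  assumes S_add: "X \<in> S \<Longrightarrow> Y \<in> S \<Longrightarrow> X + Y \<in> S"
    and S_diff: "X \<in> S \<Longrightarrow> Y \<in> S \<Longrightarrow> X - Y \<in> S"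
    and F_add: "a \<in> F \<Longrightarrow> b \<in> F \<Longrightarrow> a + b \<in> F"
    and F_diff: "a \<in> F \<Longrightarrow> b \<in> F \<Longrightarrow> a - b \<in> F"
    and N_S: "X \<in> S \<Longrightarrow> Y \<in> S \<Longrightarrow> N X Y \<in> S"
    and L_S: "X \<in> S \<Longrightarrow> Y \<in> S \<Longrightarrow> L X Y \<in> S"
    and N_add_left: "X \<in> S \<Longrightarrow> Y \<in> S \<Longrightarrow> Z \<in> S \<Longrightarrow> N (X + Y) Z = N X Z + N Y Z"
    and N_add_right: "X \<in> S \<Longrightarrow> Y \<in> S \<Longrightarrow> Z \<in> S \<Longrightarrow> N X (Y + Z) = N X Y + N X Z"
    and L_add_left: "X \<in> S \<Longrightarrow> Y \<in> S \<Longrightarrow> Z \<in> S \<Longrightarrow> L (X + Y) Z = L X Z + L Y Z"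
    and L_add_right: "X \<in> S \<Longrightarrow> Y \<in> S \<Longrightarrow> Z \<in> S \<Longrightarrow> L X (Y + Z) = L X Y + L X Z"
    and G_F: "X \<in> S \<Longrightarrow> Y \<in> S \<Longrightarrow> G X Y \<in> F"
    and G_sym: "X \<in> S \<Longrightarrow> Y \<in> S \<Longrightarrow> G X Y = G Y X"
    and G_add_left: "X \<in> S \<Longrightarrow> Y \<in> S \<Longrightarrow> Z \<in> S \<Longrightarrow> G (X + Y) Z = G X Z + G Y Z"
    and d_add: "X \<in> S \<Longrightarrow> a \<in> F \<Longrightarrow> b \<in> F \<Longrightarrow> d X (a + b) = d X a + d X b"
    and d_F: "X \<in> S \<Longrightarrow> a \<in> F \<Longrightarrow> d X a \<in> F"
    and d_add_left: "X \<in> S \<Longrightarrow> Y \<in> S \<Longrightarrow> a \<in> F \<Longrightarrow> d (X + Y) a = d X a + d Y a"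
    and d_bracket: "X \<in> S \<Longrightarrow> Y \<in> S \<Longrightarrow> a \<in> F \<Longrightarrow> d X (d Y a) - d Y (d X a) = d (L X Y - L Y X) a"
    and N_metric: "X \<in> S \<Longrightarrow> Y \<in> S \<Longrightarrow> Z \<in> S \<Longrightarrow> d X (G Y Z) = G (N X Y) Z + G Y (N X Z)"
    and L_metric: "X \<in> S \<Longrightarrow> Y \<in> S \<Longrightarrow> Z \<in> S \<Longrightarrow> d X (G Y Z) = G (L X Y) Z + G Y (L X Z)"
    and jacobi: "X \<in> S \<Longrightarrow> Y \<in> S \<Longrightarrow> Z \<in> S \<Longrightarrow>
      (L X (L Y Z - L Z Y) - L (L Y Z - L Z Y) X) + (L Y (L Z X - L X Z) - L (L Z X - L X Z) Y)
      + (L Z (L X Y - L Y X) - L (L X Y - L Y X) Z) = 0"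
begin

section \<open>Torsion, curvature and the contorsion A = L - N\<close>

definition lie where "lie X Y = L X Y - L Y X"
definition contor where "contor X Y = L X Y - N X Y"
definition tor where "tor X Y = N X Y - N Y X - lie X Y"
definition curv where "curv X Y Z = N X (N Y Z) - N Y (N X Z) - N (lie X Y) Z"
definition curvL where "curvL X Y Z = L X (L Y Z) - L Y (L X Z) - L (lie X Y) Z"
definition dtor where "dtor Z X Y = N Z (tor X Y) - tor (N Z X) Y - tor X (N Z Y)"

lemma N_diff_left: "X \<in> S \<Longrightarrow> Y \<in> S \<Longrightarrow> Z \<in> S \<Longrightarrow> N (X - Y) Z = N X Z - N Y Z"
  using N_add_left[of "X - Y" Y Z] S_diff by simp

lemma N_diff_right: "X \<in> S \<Longrightarrow> Y \<in> S \<Longrightarrow> Z \<in> S \<Longrightarrow> N X (Y - Z) = N X Y - N X Z"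
  using N_add_right[of X "Y - Z" Z] S_diff by simp

lemma L_diff_left: "X \<in> S \<Longrightarrow> Y \<in> S \<Longrightarrow> Z \<in> S \<Longrightarrow> L (X - Y) Z = L X Z - L Y Z"
  using L_add_left[of "X - Y" Y Z] S_diff by simp

lemma L_diff_right: "X \<in> S \<Longrightarrow> Y \<in> S \<Longrightarrow> Z \<in> S \<Longrightarrow> L X (Y - Z) = L X Y - L X Z"
  using L_add_right[of X "Y - Z" Z] S_diff by simp

lemma G_diff_left: "X \<in> S \<Longrightarrow> Y \<in> S \<Longrightarrow> Z \<in> S \<Longrightarrow> G (X - Y) Z = G X Z - G Y Z"
  using G_add_left[of "X - Y" Y Z] S_diff by simp

lemma G_diff_right: "X \<in> S \<Longrightarrow> Y \<in> S \<Longrightarrow> Z \<in> S \<Longrightarrow> G X (Y - Z) = G X Y - G X Z"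
  by (metis G_diff_left G_sym S_diff)

lemma G_add_right: "X \<in> S \<Longrightarrow> Y \<in> S \<Longrightarrow> Z \<in> S \<Longrightarrow> G X (Y + Z) = G X Y + G X Z"
  by (metis G_add_left G_sym S_add)

lemma d_diff: "X \<in> S \<Longrightarrow> a \<in> F \<Longrightarrow> b \<in> F \<Longrightarrow> d X (a - b) = d X a - d X b"
  using d_add[of X "a - b" b] F_diff by simp

lemma d_diff_left: "X \<in> S \<Longrightarrow> Y \<in> S \<Longrightarrow> a \<in> F \<Longrightarrow> d (X - Y) a = d X a - d Y a"
  using d_add_left[of "X - Y" Y a] S_diff by simp

lemma N_zero_left: "X \<in> S \<Longrightarrow> N 0 X = 0"
  using N_diff_left[of X X X] by simp

lemma N_zero_right: "X \<in> S \<Longrightarrow> N X 0 = 0"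
  using N_diff_right[of X X X] by simp

lemma L_zero_left: "X \<in> S \<Longrightarrow> L 0 X = 0"
  using L_diff_left[of X X X] by simp

lemma L_zero_right: "X \<in> S \<Longrightarrow> L X 0 = 0"
  using L_diff_right[of X X X] by simp

lemma G_zero_left: "X \<in> S \<Longrightarrow> G 0 X = 0"
  using G_diff_left[of X X X] by simp

lemma zero_S: "X \<in> S \<Longrightarrow> 0 \<in> S"
  using S_diff[of X X] by simp

lemma minus_S: "X \<in> S \<Longrightarrow> - X \<in> S"
  using S_diff[of 0 X] zero_S by simp

lemma N_minus_left: "X \<in> S \<Longrightarrow> Y \<in> S \<Longrightarrow> N (- X) Y = - N X Y"
  using N_diff_left[of 0 X Y] zero_S N_zero_left by simp

lemma N_minus_right: "X \<in> S \<Longrightarrow> Y \<in> S \<Longrightarrow> N X (- Y) = - N X Y"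
  using N_diff_right[of X 0 Y] zero_S N_zero_right by simp

lemma G_minus_left: "X \<in> S \<Longrightarrow> Y \<in> S \<Longrightarrow> G (- X) Y = - G X Y"
  using G_diff_left[of 0 X Y] zero_S G_zero_left by simp

lemmas diffs = N_diff_left N_diff_right L_diff_left L_diff_right G_diff_left G_diff_right

lemmas closed = S_diff N_S L_S

lemma lie_S: "X \<in> S \<Longrightarrow> Y \<in> S \<Longrightarrow> lie X Y \<in> S" by (simp add: lie_def closed)

lemma contor_S: "X \<in> S \<Longrightarrow> Y \<in> S \<Longrightarrow> contor X Y \<in> S" by (simp add: contor_def closed)

lemma tor_S: "X \<in> S \<Longrightarrow> Y \<in> S \<Longrightarrow> tor X Y \<in> S" by (simp add: tor_def closed lie_S)

lemma curv_S: "X \<in> S \<Longrightarrow> Y \<in> S \<Longrightarrow> Z \<in> S \<Longrightarrow> curv X Y Z \<in> S" by (simp add: curv_def closed lie_S)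

lemma dtor_S: "X \<in> S \<Longrightarrow> Y \<in> S \<Longrightarrow> Z \<in> S \<Longrightarrow> dtor X Y Z \<in> S" by (simp add: dtor_def closed tor_S)

lemma tor_antisym: "tor Y X = - tor X Y"
  by (simp add: tor_def lie_def)

lemma tor_zero_left: "X \<in> S \<Longrightarrow> tor 0 X = 0"
  by (simp add: tor_def lie_def N_zero_left N_zero_right L_zero_left L_zero_right)

text \<open>After expansion every term containing \<open>N\<close> cancels; what survives is the
  cyclic sum of iterated brackets, which vanishes by \<open>jacobi\<close>.\<close>

lemma first_bianchi:
  assumes [simp]: "X \<in> S" "Y \<in> S" "Z \<in> S"
  shows "curv X Y Z + curv Y Z X + curv Z X Y
    = dtor X Y Z + dtor Y Z X + dtor Z X Y + (tor (tor X Y) Z + tor (tor Y Z) X + tor (tor Z X) Y)"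
  using jacobi[OF assms]
  by (simp add: curv_def dtor_def tor_def lie_def closed diffs) (simp add: algebra_simps)

text \<open>The commutator of \<open>d X\<close> and \<open>d Y\<close> on the function
  \<open>G Z W\<close> is the derivative along \<open>lie X Y\<close>. When both sides are expanded
  by the metric rule, the products of first derivatives cancel and the curvature terms
  remain.\<close>

lemma curv_skew:
  assumes [simp]: "X \<in> S" "Y \<in> S" "Z \<in> S" "W \<in> S"
  shows "G (curv X Y Z) W = - G (curv X Y W) Z"
proof -
  have "d X (d Y (G Z W)) - d Y (d X (G Z W)) = d (lie X Y) (G Z W)"
    by (simp add: d_bracket lie_def G_F)
  then have "G (curv X Y Z) W + G Z (curv X Y W) = 0"
    by (simp add: curv_def N_metric lie_S closed G_F d_add diffs) (simp add: algebra_simps)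
  then show ?thesis
    using G_sym[of Z "curv X Y W"] by (simp add: curv_S eq_neg_iff_add_eq_0)
qed

text \<open>The metric rules of \<open>N\<close> and \<open>L\<close> have the same left-hand side;
  this is their difference.\<close>

lemma contor_skew:
  assumes [simp]: "X \<in> S" "Y \<in> S" "Z \<in> S"
  shows "G (contor X Y) Z = - G (contor X Z) Y"
  using N_metric[OF assms] L_metric[OF assms] G_sym[of Y "N X Z"] G_sym[of Y "L X Z"]
  by (simp add: contor_def diffs closed algebra_simps)

lemma tor_eq_contor: "tor X Y = contor Y X - contor X Y"
  by (simp add: tor_def contor_def lie_def)

lemma G_tor:
  assumes [simp]: "X \<in> S" "Y \<in> S" "Z \<in> S"
  shows "G (tor X Y) Z = - G (contor X Y) Z - G (contor Y Z) X"
  by (simp add: tor_eq_contor G_diff_left contor_S contor_skew[of Y X Z])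

text \<open>By \<open>G_tor\<close> each torsion term is a sum of two contorsion terms. Of these
  six, four cancel and the remaining two coincide.\<close>

lemma koszul:
  assumes [simp]: "X \<in> S" "Y \<in> S" "Z \<in> S"
  shows "G (contor X Y) Z + G (contor X Y) Z = G (tor Y Z) X - G (tor X Y) Z - G (tor Z X) Y"
  by (simp add: G_tor contor_skew[of X Z Y] contor_skew[of Y X Z] contor_skew[of Z Y X])

definition dcontor where "dcontor Z W X = N Z (contor W X) - contor (N Z W) X - contor W (N Z X)"

lemma dcontor_S: "X \<in> S \<Longrightarrow> Y \<in> S \<Longrightarrow> Z \<in> S \<Longrightarrow> dcontor X Y Z \<in> S" by (simp add: dcontor_def closed contor_S)

text \<open>Since \<open>N\<close> is metric, one may differentiate \<open>koszul\<close> and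
  subtract its instances in which one of the three arguments is replaced by its derivative. This
  turns \<open>contor\<close> into \<open>dcontor\<close> and \<open>tor\<close> into
  \<open>dtor\<close>.\<close>

lemma d_koszul:
  assumes [simp]: "X \<in> S" "Y \<in> S" "Z \<in> S" "W \<in> S"
  shows "G (dcontor Z W X) Y + G (dcontor Z W X) Y
    = G (dtor Z X Y) W - G (dtor Z W X) Y - G (dtor Z Y W) X"
proof -
  have *: "d Z (G (contor W X) Y) + d Z (G (contor W X) Y)
      = d Z (G (tor X Y) W) - d Z (G (tor W X) Y) - d Z (G (tor Y W) X)"
    using koszul[of W X Y]
    by (simp flip: d_add d_diff add: G_F F_diff contor_S tor_S)
  have "G (dcontor Z W X) Y + G (dcontor Z W X) Y = (d Z (G (contor W X) Y) + d Z (G (contor W X) Y))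
      - (G (contor (N Z W) X) Y + G (contor (N Z W) X) Y) - (G (contor W (N Z X)) Y + G (contor W (N Z X)) Y)
      - (G (contor W X) (N Z Y) + G (contor W X) (N Z Y))"
    by (simp add: dcontor_def N_metric diffs closed contor_S)
  also have "\<dots> = G (dtor Z X Y) W - G (dtor Z W X) Y - G (dtor Z Y W) X"
    by (simp add: * koszul N_S N_metric tor_S dtor_def diffs closed)
  finally show ?thesis .
qed

text \<open>Substitute L = N + A in every derivative. The two \<open>dcontor\<close> terms subtract
  A in the direction \<open>N Z W - N W Z\<close>, whereas \<open>curvL\<close> contains A in the
  direction \<open>lie Z W\<close>; these directions differ by \<open>tor Z W\<close>.\<close>

lemma curvL_eq:
  assumes [simp]: "X \<in> S" "Z \<in> S" "W \<in> S"
  shows "curvL Z W X = curv Z W X + dcontor Z W X - dcontor W Z X + contor (tor Z W) X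
    + contor Z (contor W X) - contor W (contor Z X)"
  by (simp add: curvL_def curv_def dcontor_def tor_def contor_def lie_def closed diffs)

text \<open>Skewness moves the outer A to \<open>Y\<close>. The commutator thus becomes metric
  products of A applied to given fields, which a frame evaluates without expanding an argument of
  A.\<close>

lemma curvature_difference:
  assumes [simp]: "X \<in> S" "Y \<in> S" "Z \<in> S" "W \<in> S"
  shows "G (curvL Z W X) Y = G (curv Z W X) Y + G (dcontor Z W X) Y - G (dcontor W Z X) Y
    + G (contor (tor Z W) X) Y - G (contor W X) (contor Z Y) + G (contor Z X) (contor W Y)"
  by (simp add: curvL_eq G_add_left G_diff_left curv_S dcontor_S contor_S tor_S S_diff S_add
      contor_skew[of Z "contor W X" Y] contor_skew[of W "contor Z X" Y] G_sym[of "contor Z Y" "contor W X"] G_sym[of "contor W Y" "contor Z X"])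
end

section \<open>Smooth functions and vector fields\<close>

lemma Ck_on_subset: "Ck_on k S f \<Longrightarrow> T \<subseteq> S \<Longrightarrow> Ck_on k T f"
  by (induction k arbitrary: f) (auto intro: continuous_on_subset)

text \<open>On an open set derivatives depend only on values in the set, so the induction passes to
  the derivatives. This is what permits changing functions and fields outside
  \<open>U\<close>.\<close>

lemma Ck_on_cong:
  assumes "open S" "\<And>x. x \<in> S \<Longrightarrow> f x = h x" "Ck_on k S f"
  shows "Ck_on k S h"
  using assms(2,3)
proof (induction k arbitrary: f h)
  case 0
  then show ?case using continuous_on_cong[of S S f h] by simp
next
  case (Suc k)
  have *: "(h has_derivative frechet_derivative f (at x)) (at x)" if "x \<in> S" for x
    using Suc.prems that assms(1)
    by (intro has_derivative_transform_within_open[of f _ _ _ S h]) (auto simp flip: frechet_derivative_works)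
  then have "frechet_derivative h (at x) = frechet_derivative f (at x)" if "x \<in> S" for x
    using frechet_derivative_at[OF *[OF that]] by simp
  then have "Ck_on k S (\<lambda>x. frechet_derivative h (at x) v)" for v
    using Suc.IH[of "\<lambda>x. frechet_derivative f (at x) v"] Suc.prems by simp
  then show ?case using * by (auto simp: differentiable_def)
qed

lemma Ck_on_cong_iff:
  "open S \<Longrightarrow> (\<And>x. x \<in> S \<Longrightarrow> f x = h x) \<Longrightarrow> Ck_on k S f \<longleftrightarrow> Ck_on k S h"
  by (metis Ck_on_cong)

lemma Ck_on_add:
  assumes "open S" "Ck_on k S f" "Ck_on k S h"
  shows "Ck_on k S (\<lambda>x. f x + h x)"
  using assms(2,3)
proof (induction k arbitrary: f h)
  case 0
  then show ?case by (simp add: continuous_on_add)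
next
  case (Suc k)
  have "frechet_derivative (\<lambda>x. f x + h x) (at x) v
      = frechet_derivative f (at x) v + frechet_derivative h (at x) v" if "x \<in> S" for x v
  proof -
    have "((\<lambda>x. f x + h x) has_derivative
        (\<lambda>v. frechet_derivative f (at x) v + frechet_derivative h (at x) v)) (at x)"
      using Suc.prems that by (intro has_derivative_add) (auto simp flip: frechet_derivative_works)
    from fun_cong[OF frechet_derivative_at[OF this, symmetric]] show ?thesis .
  qed
  then have "Ck_on k S (\<lambda>x. frechet_derivative (\<lambda>x. f x + h x) (at x) v)" for v
    using Suc.prems Suc.IH[of "\<lambda>x. frechet_derivative f (at x) v" "\<lambda>x. frechet_derivative h (at x) v"]
    by (subst Ck_on_cong_iff[OF assms(1)]) auto
  with Suc.prems show ?case by simp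
qed

lemma Ck_on_scale:
  fixes f :: "'e::euclidean_space \<Rightarrow> real"
  assumes "open S" "Ck_on k S f"
  shows "Ck_on k S (\<lambda>x. c * f x)"
  using assms(2)
proof (induction k arbitrary: f)
  case 0
  then show ?case by (simp add: continuous_on_mult_left)
next
  case (Suc k)
  have "frechet_derivative (\<lambda>x. c * f x) (at x) v = c * frechet_derivative f (at x) v"
    if "x \<in> S" for x v
  proof -
    have "((\<lambda>x. c * f x) has_derivative (\<lambda>v. c * frechet_derivative f (at x) v)) (at x)"
      using Suc.prems that by (intro has_derivative_mult_right) (auto simp flip: frechet_derivative_works)
    from fun_cong[OF frechet_derivative_at[OF this, symmetric]] show ?thesis .
  qed
  then have "Ck_on k S (\<lambda>x. frechet_derivative (\<lambda>x. c * f x) (at x) v)" for v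
    using Suc.prems Suc.IH[of "\<lambda>x. frechet_derivative f (at x) v"]
    by (subst Ck_on_cong_iff[OF assms(1)]) auto
  with Suc.prems show ?case by (simp add: differentiable_mult)
qed

text \<open>Fields only matter on \<open>U\<close>. Cutting values off outside \<open>U\<close> turns identities valid on \<open>U\<close> into
  equations between total functions.\<close>

definition cutoff :: "'a set \<Rightarrow> ('a \<Rightarrow> 'b::zero) \<Rightarrow> 'a \<Rightarrow> 'b" where
  "cutoff U h = (\<lambda>q. if q \<in> U then h q else 0)"

lemma cutoff_in [simp]: "q \<in> U \<Longrightarrow> cutoff U h q = h q"
  by (simp add: cutoff_def)

lemma cutoff_notin [simp]: "q \<notin> U \<Longrightarrow> cutoff U h q = 0"
  by (simp add: cutoff_def)

lemma cutoff_eqI: "(\<And>q. q \<in> U \<Longrightarrow> h q = k q) \<Longrightarrow> cutoff U h = cutoff U k"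
  by (auto simp: cutoff_def)

lemma cutoff_plus_eqI:
  "(\<And>q. q \<in> U \<Longrightarrow> h q = k q + l q) \<Longrightarrow> cutoff U h = cutoff U k + cutoff U (l :: _ \<Rightarrow> _::monoid_add)"
  by (auto simp: cutoff_def)

lemma eventually_nhds_open: "open U \<Longrightarrow> p \<in> U \<Longrightarrow> (\<And>q. q \<in> U \<Longrightarrow> P q) \<Longrightarrow> \<forall>\<^sub>F q in nhds p. P q"
  by (auto simp: eventually_nhds)

locale smooth_manifold =
  fixes M :: "('a::{t2_space, second_countable_topology}, 'e::euclidean_space) atlas"
  assumes atlas: "smooth_atlas M"
begin

lemma open_chart_image:
  assumes "(W, \<phi>) \<in> M" "open V"
  shows "open (\<phi> ` (W \<inter> V))"
proof -
  have W: "open (\<phi> ` W)" and h: "homeomorphism W (\<phi> ` W) \<phi> (inv_into W \<phi>)"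
    using atlas assms(1) by (auto simp: smooth_atlas_def)
  have "\<phi> ` (W \<inter> V) = \<phi> ` W \<inter> inv_into W \<phi> -` V"
    using h by (auto simp: homeomorphism_def)
  then show ?thesis
    using continuous_open_preimage[OF homeomorphism_cont2[OF h] W assms(2)] by simp
qed

lemma inv_chart: "(W, \<phi>) \<in> M \<Longrightarrow> x \<in> W \<Longrightarrow> inv_into W \<phi> (\<phi> x) = x"
  using atlas unfolding smooth_atlas_def by (metis (mono_tags, lifting) case_prodD homeomorphism_apply1)

lemma smooth_fun_iff: "smooth_fun M V f \<longleftrightarrow> open V \<and> V \<subseteq> points M \<and>
    (\<forall>W \<phi> k. (W, \<phi>) \<in> M \<longrightarrow> Ck_on k (\<phi> ` (W \<inter> V)) (\<lambda>y. f (inv_into W \<phi> y)))"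
  by (simp add: smooth_fun_def Cinf_on_def comp_def split_beta Ball_def)

lemma smooth_funD:
  assumes "smooth_fun M V f"
  shows smooth_fun_open: "open V" and smooth_fun_points: "V \<subseteq> points M"
    and smooth_fun_Ck: "(W, \<phi>) \<in> M \<Longrightarrow> Ck_on k (\<phi> ` (W \<inter> V)) (\<lambda>y. f (inv_into W \<phi> y))"
  using assms by (simp_all add: smooth_fun_iff)

lemma smooth_fun_subset:
  assumes "smooth_fun M V f" "open W" "W \<subseteq> V"
  shows "smooth_fun M W f"
  unfolding smooth_fun_iff
proof (intro conjI allI impI)
  show "W \<subseteq> points M" using assms smooth_fun_points by blast
  show "Ck_on k (\<phi> ` (Y \<inter> W)) (\<lambda>y. f (inv_into Y \<phi> y))" if "(Y, \<phi>) \<in> M" for Y \<phi> k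
    by (rule Ck_on_subset[OF smooth_fun_Ck[OF assms(1) that]]) (use assms(3) in auto)
qed (rule assms(2))

lemma smooth_fun_cong:
  assumes "smooth_fun M V f" "\<And>q. q \<in> V \<Longrightarrow> f q = h q"
  shows "smooth_fun M V h"
  unfolding smooth_fun_iff
proof (intro conjI allI impI)
  show "Ck_on k (\<phi> ` (W \<inter> V)) (\<lambda>y. h (inv_into W \<phi> y))" if "(W, \<phi>) \<in> M" for k W \<phi>
  proof (rule Ck_on_cong)
    show "open (\<phi> ` (W \<inter> V))" by (rule open_chart_image[OF that smooth_fun_open[OF assms(1)]])
    show "f (inv_into W \<phi> y) = h (inv_into W \<phi> y)" if "y \<in> \<phi> ` (W \<inter> V)" for y
      using that inv_chart[OF \<open>(W, \<phi>) \<in> M\<close>] assms(2) by auto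
    show "Ck_on k (\<phi> ` (W \<inter> V)) (\<lambda>y. f (inv_into W \<phi> y))"
      by (rule smooth_fun_Ck[OF assms(1) that])
  qed
qed (rule smooth_fun_open[OF assms(1)] smooth_fun_points[OF assms(1)])+

lemma smooth_fun_add:
  assumes "smooth_fun M V f" "smooth_fun M V h"
  shows "smooth_fun M V (\<lambda>q. f q + h q)"
  using assms by (simp add: smooth_fun_iff Ck_on_add open_chart_image)

lemma smooth_fun_scale:
  assumes "smooth_fun M V f"
  shows "smooth_fun M V (\<lambda>q. c * f q)"
  using assms by (simp add: smooth_fun_iff Ck_on_scale open_chart_image)

lemma smooth_fun_diff:
  assumes "smooth_fun M V f" "smooth_fun M V h"
  shows "smooth_fun M V (\<lambda>q. f q - h q)"
  using smooth_fun_add[OF assms(1) smooth_fun_scale[OF assms(2), of "-1"]] by simp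

lemma smooth_near_scale: "smooth_near M p f \<Longrightarrow> smooth_near M p (\<lambda>q. c * f q)"
  unfolding smooth_near_def by (blast intro: smooth_fun_scale)

lemma
  assumes "v \<in> tangent_space M p" "smooth_near M p f"
  shows tangent_space_add: "smooth_near M p h \<Longrightarrow> v (\<lambda>q. f q + h q) = v f + v h"
    and tangent_space_scale: "v (\<lambda>q. c * f q) = c * v f"
    and tangent_space_germ: "(\<forall>\<^sub>F q in nhds p. f q = h q) \<Longrightarrow> v f = v h"
  using assms unfolding tangent_space_def by simp_all

lemma tangent_space_comb:
  assumes "v \<in> tangent_space M p" "w \<in> tangent_space M p"
  shows "(\<lambda>f. a * v f + b * w f) \<in> tangent_space M p"
proof -
  have "a * v f + b * w f = a * v h + b * w h"
    if "smooth_near M p f" "\<forall>\<^sub>F q in nhds p. f q = h q" for f h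
    using tangent_space_germ[OF assms(1) that] tangent_space_germ[OF assms(2) that] by simp
  moreover have "a * v f + b * w f = 0" if "\<not> smooth_near M p f" for f
    using assms that by (simp add: tangent_space_def)
  moreover have "a * v (\<lambda>q. f q * h q) + b * w (\<lambda>q. f q * h q)
      = (a * v f + b * w f) * h p + f p * (a * v h + b * w h)"
    if "smooth_near M p f" "smooth_near M p h" for f h
    using assms that by (simp add: tangent_space_def algebra_simps)
  ultimately show ?thesis
    using assms tangent_space_add tangent_space_scale
    unfolding tangent_space_def[where p = p] mem_Collect_eq by (simp add: algebra_simps)
qed

lemma tangent_space_diff_fun:
  assumes "v \<in> tangent_space M p" "smooth_near M p f" "smooth_near M p h"
  shows "v (\<lambda>q. f q - h q) = v f - v h"
proof -
  have "v (\<lambda>q. f q + (-1) * h q) = v f + (-1) * v h"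
    by (simp only: tangent_space_add[OF assms(1,2) smooth_near_scale[OF assms(3)]]
      tangent_space_scale[OF assms(1,3)])
  then show ?thesis by simp
qed

lemma smooth_vfield_comb:
  assumes "smooth_vfield M U X" "smooth_vfield M U Y"
  shows "smooth_vfield M U (\<lambda>p f. a * X p f + b * Y p f)"
  using assms by (simp add: smooth_vfield_def smooth_fun_add smooth_fun_scale tangent_space_comb)

lemma smooth_vfield_cong:
  assumes "smooth_vfield M U X" "\<And>q. q \<in> U \<Longrightarrow> X q = Y q"
  shows "smooth_vfield M U Y"
proof -
  have "smooth_fun M V (\<lambda>p. Y p f)" if "V \<subseteq> U" "smooth_fun M V f" for V f
  proof (rule smooth_fun_cong)
    show "smooth_fun M V (\<lambda>p. X p f)" using assms(1) that by (simp add: smooth_vfield_def)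
  qed (use that(1) assms(2) in auto)
  then show ?thesis using assms by (simp add: smooth_vfield_def)
qed

lemma smooth_vfield_open: "smooth_vfield M U X \<Longrightarrow> open U"
  by (simp add: smooth_vfield_def)

lemma smooth_vfield_tangent: "smooth_vfield M U X \<Longrightarrow> q \<in> U \<Longrightarrow> X q \<in> tangent_space M q"
  by (simp add: smooth_vfield_def)

lemma smooth_vfield_apply:
  "smooth_vfield M U X \<Longrightarrow> V \<subseteq> U \<Longrightarrow> smooth_fun M V f \<Longrightarrow> smooth_fun M V (\<lambda>p. X p f)"
  by (simp add: smooth_vfield_def)

lemma smooth_vfield_add:
  assumes "smooth_vfield M U X" "smooth_vfield M U Y"
  shows "smooth_vfield M U (X + Y)"
  using smooth_vfield_comb[OF assms, of 1 1] by (simp add: plus_fun_def)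

lemma smooth_vfield_diff:
  assumes "smooth_vfield M U X" "smooth_vfield M U Y"
  shows "smooth_vfield M U (X - Y)"
  using smooth_vfield_comb[OF assms, of 1 "-1"] by (simp add: fun_diff_def)

text \<open>Smoothness on \<open>U\<close> ignores values outside \<open>U\<close>, so cutting off
  never leaves the carriers of the algebra.\<close>

lemma smooth_vfield_cutoff: "smooth_vfield M U (cutoff U X) \<longleftrightarrow> smooth_vfield M U X"
  by (rule iffI; erule smooth_vfield_cong) simp_all

lemma smooth_fun_cutoff: "smooth_fun M U (cutoff U h) \<longleftrightarrow> smooth_fun M U h"
  by (rule iffI; erule smooth_fun_cong) simp_all

lemma smooth_near_mem: "smooth_fun M V f \<Longrightarrow> p \<in> V \<Longrightarrow> smooth_near M p f"
  by (auto simp: smooth_near_def)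

text \<open>\<open>B\<close> stands for any operation that agrees with the bracket on
  \<open>U\<close>; the cut-off bracket is inserted for it later. On a function smooth near
  \<open>p\<close> each double bracket consists of four threefold derivatives, and the twelve terms
  of the cyclic sum cancel in pairs.\<close>

lemma jacobi_bracket:
  assumes B: "\<And>X Y. smooth_vfield M U X \<Longrightarrow> smooth_vfield M U Y \<Longrightarrow> smooth_vfield M U (B X Y)"
    and lie: "\<And>X Y q. smooth_vfield M U X \<Longrightarrow> smooth_vfield M U Y \<Longrightarrow> q \<in> U \<Longrightarrow> B X Y q = lie_bracket M X Y q"
    and X: "smooth_vfield M U X" and Y: "smooth_vfield M U Y" and Z: "smooth_vfield M U Z"
    and p: "p \<in> U"
  shows "B X (B Y Z) p + B Y (B Z X) p + B Z (B X Y) p = 0"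
proof
  fix f
  show "(B X (B Y Z) p + B Y (B Z X) p + B Z (B X Y) p) f = 0 f"
  proof (cases "smooth_near M p f")
    case False
    then show ?thesis using X Y Z p B lie by (simp add: lie_bracket_def)
  next
    case True
    then obtain W where W: "p \<in> W" "smooth_fun M W f" by (auto simp: smooth_near_def)
    define V where "V = W \<inter> U"
    have V: "p \<in> V" "V \<subseteq> U" "open V" using W p smooth_fun_open[of W f] smooth_vfield_open[OF X]
      by (auto simp: V_def)
    have f: "smooth_fun M V f" using smooth_fun_subset[OF W(2) V(3)] by (simp add: V_def)
    have *: "B P (B Q R) p f = P p (\<lambda>q. Q q (\<lambda>r. R r f)) - P p (\<lambda>q. R q (\<lambda>r. Q r f))
        - Q p (\<lambda>q. R q (\<lambda>r. P r f)) + R p (\<lambda>q. Q q (\<lambda>r. P r f))"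
      if P: "smooth_vfield M U P" and Q: "smooth_vfield M U Q" and R: "smooth_vfield M U R" for P Q R
    proof -
      have Pf: "smooth_fun M V (\<lambda>q. P q f)" and Qf: "smooth_fun M V (\<lambda>q. Q q f)" and Rf: "smooth_fun M V (\<lambda>q. R q f)"
        using P Q R V f smooth_vfield_apply by auto
      have QRf: "smooth_fun M V (\<lambda>q. Q q (\<lambda>r. R r f))" and RQf: "smooth_fun M V (\<lambda>q. R q (\<lambda>r. Q r f))"
        using smooth_vfield_apply[OF Q V(2) Rf] smooth_vfield_apply[OF R V(2) Qf] by auto
      have BQR: "B Q R q f = Q q (\<lambda>r. R r f) - R q (\<lambda>r. Q r f)" if "q \<in> V" for q
        using lie[OF Q R] that V smooth_near_mem[OF f that] by (auto simp: lie_bracket_def)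
      \<comment> \<open>\<open>B Q R q f\<close> is known as a difference only for \<open>q\<close>
        in \<open>V\<close>; this suffices because \<open>P p\<close> depends only on the germ at
        \<open>p\<close>.\<close>
      have "P p (\<lambda>q. B Q R q f) = P p (\<lambda>q. Q q (\<lambda>r. R r f) - R q (\<lambda>r. Q r f))"
        using smooth_vfield_apply[OF B[OF Q R] V(2) f] BQR V p
        by (intro tangent_space_germ[OF smooth_vfield_tangent[OF P p]] smooth_near_mem[of V]
            eventually_nhds_open[of V]) auto
      also have "\<dots> = P p (\<lambda>q. Q q (\<lambda>r. R r f)) - P p (\<lambda>q. R q (\<lambda>r. Q r f))"
        using smooth_near_mem[OF QRf V(1)] smooth_near_mem[OF RQf V(1)]
        by (rule tangent_space_diff_fun[OF smooth_vfield_tangent[OF P p]])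
      finally have 1: "P p (\<lambda>q. B Q R q f) = P p (\<lambda>q. Q q (\<lambda>r. R r f)) - P p (\<lambda>q. R q (\<lambda>r. Q r f))" .
      have "B P (B Q R) p f = P p (\<lambda>q. B Q R q f) - B Q R p (\<lambda>q. P q f)"
        using lie[OF P B[OF Q R] p] True by (simp add: lie_bracket_def)
      moreover have "B Q R p (\<lambda>q. P q f) = Q p (\<lambda>q. R q (\<lambda>r. P r f)) - R p (\<lambda>q. Q q (\<lambda>r. P r f))"
        using lie[OF Q R p] smooth_near_mem[OF Pf V(1)] by (simp add: lie_bracket_def)
      ultimately show ?thesis using 1 by simp
    qed
    show ?thesis using *[OF X Y Z] *[OF Y Z X] *[OF Z X Y] by simp
  qed
qed

section \<open>Covariant derivatives and the metric on smooth fields\<close>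

lemma cov_props:
  assumes "connection M D" "smooth_vfield M U X" "smooth_vfield M U Y" "smooth_vfield M U Z" "q \<in> U"
  shows cov_add_left: "cov D (X + Y) Z q = cov D X Z q + cov D Y Z q"
    and cov_add_right: "cov D X (Y + Z) q = cov D X Y q + cov D X Z q"
proof -
  note c = assms(1)[unfolded connection_def, THEN spec, THEN spec, THEN mp, THEN conjunct1,
    THEN bspec[OF _ assms(5)], THEN bspec[OF _ smooth_vfield_tangent[OF assms(2,5)]], THEN conjunct2]
  have "D q (\<lambda>f. 1 * X q f + 1 * Y q f) Z = (\<lambda>f. 1 * D q (X q) Z f + 1 * D q (Y q) Z f)"
    by (rule c[OF assms(4), THEN conjunct1, THEN bspec[OF _ smooth_vfield_tangent[OF assms(3,5)]], THEN spec, THEN spec])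
  then show "cov D (X + Y) Z q = cov D X Z q + cov D Y Z q" by (simp add: cov_def plus_fun_def)
  have "D q (X q) (\<lambda>r f. Y r f + Z r f) = (\<lambda>f. D q (X q) Y f + D q (X q) Z f)"
    by (rule c[OF assms(3), THEN conjunct2, THEN conjunct1, THEN spec, THEN mp, OF assms(4)])
  then show "cov D X (Y + Z) q = cov D X Y q + cov D X Z q" by (simp add: cov_def plus_fun_def)
qed

lemma cov_smooth:
  assumes "connection M D" "smooth_vfield M U X" "smooth_vfield M U Y"
  shows "smooth_vfield M U (cov D X Y)"
  unfolding cov_def
  by (rule assms(1)[unfolded connection_def, THEN spec, THEN spec, THEN mp, OF assms(3),
    THEN conjunct2, THEN spec, THEN mp, OF assms(2)])

lemma cov_cong_right:
  assumes "connection M D" "smooth_vfield M U X" "smooth_vfield M U Y" "\<And>q. q \<in> U \<Longrightarrow> Y q = Z q" "q \<in> U"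
  shows "cov D X Y q = cov D X Z q"
  unfolding cov_def
  by (rule assms(1)[unfolded connection_def, THEN spec, THEN spec, THEN mp, OF assms(3), THEN conjunct1,
    THEN bspec[OF _ assms(5)], THEN bspec[OF _ smooth_vfield_tangent[OF assms(2,5)]],
    THEN conjunct2, THEN conjunct2, THEN conjunct2, THEN conjunct2, THEN spec, THEN mp]) (use assms(4) in simp)

lemma metric_props:
  assumes "riemannian_metric M g" "smooth_vfield M U X" "smooth_vfield M U Y"
  shows metric_smooth: "smooth_fun M U (\<lambda>q. g q (X q) (Y q))"
    and metric_sym: "q \<in> U \<Longrightarrow> g q (X q) (Y q) = g q (Y q) (X q)"
    and metric_add: "q \<in> U \<Longrightarrow> smooth_vfield M U Z \<Longrightarrow>
      g q (X q + Y q) (Z q) = g q (X q) (Z q) + g q (Y q) (Z q)"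
proof -
  note c = assms(1)[unfolded riemannian_metric_def]
  show "smooth_fun M U (\<lambda>q. g q (X q) (Y q))"
    by (rule c[THEN conjunct2, THEN conjunct2, THEN spec, THEN spec, THEN spec, THEN mp,
          THEN mp, OF assms(2,3)])
  assume q: "q \<in> U"
  then have "q \<in> points M" using assms(2) by (auto simp: smooth_vfield_def)
  note * = c[THEN conjunct1, THEN bspec[OF _ this], THEN bspec[OF _ smooth_vfield_tangent[OF assms(2) q]]]
  show "g q (X q) (Y q) = g q (Y q) (X q)"
    by (rule *[THEN bspec[OF _ smooth_vfield_tangent[OF assms(3) q]], THEN conjunct1])
  assume Z: "smooth_vfield M U Z"
  have "g q (\<lambda>f. 1 * X q f + 1 * Y q f) (Z q) = 1 * g q (X q) (Z q) + 1 * g q (Y q) (Z q)"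
    using c \<open>q \<in> points M\<close> smooth_vfield_tangent[OF assms(2) q] smooth_vfield_tangent[OF assms(3) q]
      smooth_vfield_tangent[OF Z q]
    by fast
  then show "g q (X q + Y q) (Z q) = g q (X q) (Z q) + g q (Y q) (Z q)" by (simp add: plus_fun_def)
qed

text \<open>The differentiated function is itself cut off, but at points of the open set
  \<open>U\<close> this leaves its germ unchanged.\<close>

lemma connection_metric:
  assumes g: "riemannian_metric M g" and D: "connection M D" "metric_connection M g D"
    and "smooth_vfield M U X" "smooth_vfield M U Y" "smooth_vfield M U Z"
  shows "cutoff U (\<lambda>q. X q (cutoff U (\<lambda>r. g r (Y r) (Z r))))
    = cutoff U (\<lambda>r. g r (cutoff U (cov D X Y) r) (Z r)) + cutoff U (\<lambda>r. g r (Y r) (cutoff U (cov D X Z) r))"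
proof
  fix q
  have "X q (cutoff U (\<lambda>r. g r (Y r) (Z r))) = X q (\<lambda>r. g r (Y r) (Z r))" if "q \<in> U"
  proof (rule tangent_space_germ[of "X q", symmetric])
    show "X q \<in> tangent_space M q" using assms(4) that by (rule smooth_vfield_tangent)
    have "smooth_fun M U (\<lambda>r. g r (Y r) (Z r))"
      by (rule metric_smooth[OF g assms(5,6)])
    then show "smooth_near M q (\<lambda>r. g r (Y r) (Z r))" using that by (rule smooth_near_mem)
    show "\<forall>\<^sub>F r in nhds q. g r (Y r) (Z r) = cutoff U (\<lambda>r. g r (Y r) (Z r)) r"
      using smooth_vfield_open[OF assms(4)] that by (rule eventually_nhds_open) simp
  qed
  moreover have "X q (\<lambda>r. g r (Y r) (Z r)) = g q (cov D X Y q) (Z q) + g q (Y q) (cov D X Z q)" if "q \<in> U"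
    using D(2)[unfolded metric_connection_def, THEN spec, THEN spec, THEN spec, THEN spec,
        THEN mp, THEN mp, THEN mp, OF assms(4-6)] that by (rule bspec)
  ultimately show "cutoff U (\<lambda>q. X q (cutoff U (\<lambda>r. g r (Y r) (Z r)))) q
    = (cutoff U (\<lambda>r. g r (cutoff U (cov D X Y) r) (Z r)) + cutoff U (\<lambda>r. g r (Y r) (cutoff U (cov D X Z) r))) q"
    by (cases "q \<in> U") simp_all
qed

lemma lie_bracket_at:
  assumes "levi_civita_connection M g DL" "smooth_vfield M U X" "smooth_vfield M U Y" "q \<in> U"
  shows "lie_bracket M X Y q = cov DL X Y q - cov DL Y X q"
proof
  fix f
  have "torsion (cov DL) (lie_bracket M) X Y q = (\<lambda>f. 0)"
    by (rule assms(1)[unfolded levi_civita_connection_def, THEN conjunct2, THEN conjunct2, THEN spec,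
        THEN spec, THEN spec, THEN mp, THEN mp, OF assms(2,3), THEN bspec, OF assms(4)])
  from fun_cong[OF this, of f] show "lie_bracket M X Y q f = (cov DL X Y q - cov DL Y X q) f"
    by (simp add: torsion_def)
qed

text \<open>The carriers admit arbitrary values outside \<open>U\<close>, while every operation
  returns 0 there. Each equational axiom is thus an equation of total functions with content on
  \<open>U\<close> only.\<close>

lemma real_fields_model:
  assumes g: "riemannian_metric M g" and D: "connection M D" "metric_connection M g D"
    and L: "levi_civita_connection M g DL"
  shows "two_metric_connections {X. smooth_vfield M U X} {h. smooth_fun M U h}
    (\<lambda>X Y. cutoff U (cov D X Y)) (\<lambda>X Y. cutoff U (cov DL X Y))
    (\<lambda>X Y. cutoff U (\<lambda>q. g q (X q) (Y q))) (\<lambda>X h. cutoff U (\<lambda>q. X q h))"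
proof -
  have DL: "connection M DL" "metric_connection M g DL" using L by (auto simp: levi_civita_connection_def)
  \<comment> \<open>Torsion-freeness of \<open>DL\<close> makes this the Lie bracket on
    \<open>U\<close>; this is how \<open>jacobi\<close> and \<open>d_bracket\<close> reach the
    abstract setting.\<close>
  define B where "B X Y = cutoff U (cov DL X Y) - cutoff U (cov DL Y X)" for X Y
  have B: "smooth_vfield M U (B X Y)" if "smooth_vfield M U X" "smooth_vfield M U Y" for X Y
    using that by (simp add: B_def smooth_vfield_diff smooth_vfield_cutoff cov_smooth[OF DL(1)])
  have lie: "B X Y q = lie_bracket M X Y q" if "smooth_vfield M U X" "smooth_vfield M U Y" "q \<in> U" for X Y q
    using lie_bracket_at[OF L that] that(3) by (simp add: B_def)
  have sym: "cutoff U (\<lambda>q. g q (X q) (Y q)) = cutoff U (\<lambda>q. g q (Y q) (X q))"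
    if "smooth_vfield M U X" "smooth_vfield M U Y" for X Y
    by (rule cutoff_eqI) (rule metric_sym[OF g that])
  have "B X (B Y Z) + B Y (B Z X) + B Z (B X Y) = 0"
    if "smooth_vfield M U X" "smooth_vfield M U Y" "smooth_vfield M U Z" for X Y Z
  proof
    show "(B X (B Y Z) + B Y (B Z X) + B Z (B X Y)) q = 0 q" for q
    proof (cases "q \<in> U")
      case True
      show ?thesis using jacobi_bracket[OF B lie that True] by (simp only: plus_fun_apply zero_fun_apply)
    next
      case False
      then show ?thesis by (simp add: B_def)
    qed
  qed
  moreover have "cutoff U (\<lambda>q. X q (h + k)) = cutoff U (\<lambda>q. X q h) + cutoff U (\<lambda>q. X q k)"
    if "smooth_vfield M U X" "smooth_fun M U h" "smooth_fun M U k" for X h k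
    using that by (intro cutoff_plus_eqI)
      (simp add: plus_fun_def tangent_space_add[OF smooth_vfield_tangent] smooth_near_mem[of U])
  moreover have "cutoff U (cov D' (X + Y) Z) = cutoff U (cov D' X Z) + cutoff U (cov D' Y Z)"
    "cutoff U (cov D' X (Y + Z)) = cutoff U (cov D' X Y) + cutoff U (cov D' X Z)"
    if "connection M D'" "smooth_vfield M U X" "smooth_vfield M U Y" "smooth_vfield M U Z" for D' X Y Z
    by (rule cutoff_plus_eqI, rule cov_add_left[OF that], assumption)
      (rule cutoff_plus_eqI, rule cov_add_right[OF that], assumption)
  moreover have "cutoff U (\<lambda>q. g q (X q + Y q) (Z q)) = cutoff U (\<lambda>q. g q (X q) (Z q)) + cutoff U (\<lambda>q. g q (Y q) (Z q))"
    if "smooth_vfield M U X" "smooth_vfield M U Y" "smooth_vfield M U Z" for X Y Z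
    by (rule cutoff_plus_eqI) (rule metric_add[OF g that(1,2) _ that(3)])
  moreover have "smooth_fun M U (h + k)" "smooth_fun M U (h - k)"
    if "smooth_fun M U h" "smooth_fun M U k" for h k
    using smooth_fun_add[OF that] smooth_fun_diff[OF that] by (simp_all add: plus_fun_def fun_diff_def)
  moreover have "smooth_fun M U (\<lambda>q. X q h)" if "smooth_vfield M U X" "smooth_fun M U h" for X h
    by (rule smooth_vfield_apply[OF that(1) _ that(2)]) simp
  moreover have "cutoff U (\<lambda>q. (X + Y) q h) = cutoff U (\<lambda>q. X q h) + cutoff U (\<lambda>q. Y q h)"
    for X Y :: "('a, real) vfield" and h
    by (rule cutoff_plus_eqI) simp
  moreover have "cutoff U (\<lambda>q. X q (cutoff U (\<lambda>r. Y r h))) - cutoff U (\<lambda>q. Y q (cutoff U (\<lambda>r. X r h)))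
      = cutoff U (\<lambda>q. B X Y q h)"
    if "smooth_vfield M U X" "smooth_vfield M U Y" "smooth_fun M U h" for X Y h
  proof
    have *: "P q (cutoff U (\<lambda>r. Q r h)) = P q (\<lambda>r. Q r h)"
      if "smooth_vfield M U P" "smooth_vfield M U Q" "q \<in> U" for P Q q
    proof (rule tangent_space_germ[of "P q", symmetric])
      show "P q \<in> tangent_space M q" using that(1,3) by (rule smooth_vfield_tangent)
      have "smooth_fun M U (\<lambda>r. Q r h)"
        by (rule smooth_vfield_apply[OF that(2) _ \<open>smooth_fun M U h\<close>]) simp
      then show "smooth_near M q (\<lambda>r. Q r h)" using that(3) by (rule smooth_near_mem)
      show "\<forall>\<^sub>F r in nhds q. Q r h = cutoff U (\<lambda>r. Q r h) r"
        using smooth_vfield_open[OF that(1)] that(3) by (rule eventually_nhds_open) simp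
    qed
    show "(cutoff U (\<lambda>q. X q (cutoff U (\<lambda>r. Y r h))) - cutoff U (\<lambda>q. Y q (cutoff U (\<lambda>r. X r h)))) q
      = cutoff U (\<lambda>q. B X Y q h) q" for q
      using *[OF that(1,2)] *[OF that(2,1)] lie[OF that(1,2)] smooth_near_mem[OF that(3)]
      by (cases "q \<in> U") (simp_all add: lie_bracket_def)
  qed
  ultimately show ?thesis
    by unfold_locales
      ((rule sym connection_metric[OF g D] connection_metric[OF g DL]; simp; fail) |
       (simp add: D(1) DL(1) smooth_vfield_add smooth_vfield_diff smooth_vfield_cutoff
        smooth_fun_cutoff cov_smooth[OF D(1)] cov_smooth[OF DL(1)] metric_smooth[OF g] flip: B_def; fail))+
qed

end

section \<open>Complexification\<close>

definition re_field :: "('a, complex) vfield \<Rightarrow> ('a, real) vfield" where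
  "re_field Z = (\<lambda>p. re_vec (Z p))"

definition im_field :: "('a, complex) vfield \<Rightarrow> ('a, real) vfield" where
  "im_field Z = (\<lambda>p. im_vec (Z p))"

lemma field_eqI: "re_field Z = re_field W \<Longrightarrow> im_field Z = im_field W \<Longrightarrow> Z = W"
  by (auto simp: re_field_def im_field_def re_vec_def im_vec_def fun_eq_iff complex_eq_iff)

lemma re_im_field [simp]:
  "re_field 0 = 0" "im_field 0 = 0"
  "re_field (Z + W) = re_field Z + re_field W" "im_field (Z + W) = im_field Z + im_field W"
  "re_field (Z - W) = re_field Z - re_field W" "im_field (Z - W) = im_field Z - im_field W"
  "re_field (cext N Z W) = N (re_field Z) (re_field W) - N (im_field Z) (im_field W)"
  "im_field (cext N Z W) = N (re_field Z) (im_field W) + N (im_field Z) (re_field W)"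
  by (auto simp: re_field_def im_field_def re_vec_def im_vec_def cext_def Let_def fun_eq_iff)

definition cfun :: "('a \<Rightarrow> real) \<Rightarrow> ('a \<Rightarrow> real) \<Rightarrow> 'a \<Rightarrow> complex" where
  "cfun h k = (\<lambda>q. Complex (h q) (k q))"

lemma re_im_cfun [simp]: "Re \<circ> cfun h k = h" "Im \<circ> cfun h k = k"
  by (auto simp: cfun_def)

lemma re_im_fun [simp]:
  "Re \<circ> (h + k) = (Re \<circ> h) + (Re \<circ> k)" "Im \<circ> (h + k) = (Im \<circ> h) + (Im \<circ> k)"
  "Re \<circ> (h - k) = (Re \<circ> h) - (Re \<circ> k)" "Im \<circ> (h - k) = (Im \<circ> h) - (Im \<circ> k)"
  by auto

lemma cfun_eqI: "Re \<circ> h = Re \<circ> k \<Longrightarrow> Im \<circ> h = Im \<circ> k \<Longrightarrow> h = k"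
  by (auto simp: fun_eq_iff complex_eq_iff)

definition cext_fun ::
  "(('a, real) vfield \<Rightarrow> ('a, real) vfield \<Rightarrow> 'a \<Rightarrow> real) \<Rightarrow>
   ('a, complex) vfield \<Rightarrow> ('a, complex) vfield \<Rightarrow> 'a \<Rightarrow> complex" where
  "cext_fun G Z W = cfun (G (re_field Z) (re_field W) - G (im_field Z) (im_field W))
     (G (re_field Z) (im_field W) + G (im_field Z) (re_field W))"

definition cext_deriv ::
  "(('a, real) vfield \<Rightarrow> ('a \<Rightarrow> real) \<Rightarrow> 'a \<Rightarrow> real) \<Rightarrow>
   ('a, complex) vfield \<Rightarrow> ('a \<Rightarrow> complex) \<Rightarrow> 'a \<Rightarrow> complex" where
  "cext_deriv d Z h = cfun (d (re_field Z) (Re \<circ> h) - d (im_field Z) (Im \<circ> h))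
     (d (re_field Z) (Im \<circ> h) + d (im_field Z) (Re \<circ> h))"

text \<open>The equational axioms are additive in every argument, so each of them splits into
  instances of the real axioms at real and imaginary parts.\<close>

lemma complexified_model:
  assumes "two_metric_connections S F N L G d"
  shows "two_metric_connections {Z. re_field Z \<in> S \<and> im_field Z \<in> S} {h. Re \<circ> h \<in> F \<and> Im \<circ> h \<in> F}
    (cext N) (cext L) (cext_fun G) (cext_deriv d)"
proof -
  interpret two_metric_connections S F N L G d by fact
  note linear = N_add_left N_add_right L_add_left L_add_right G_add_left G_add_right
    diffs d_add d_diff d_add_left d_diff_left
  note cl = S_add S_diff N_S L_S F_add F_diff G_F d_F
  \<comment> \<open>Used below only in fixed instances that move the derivative along a part of
    \<open>X\<close> inward; as a general rewrite rule it would loop.\<close>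
  have dB: "d X (d Y h) = d Y (d X h) + (d (L X Y) h - d (L Y X) h)" if "X \<in> S" "Y \<in> S" "h \<in> F" for X Y h
    using d_bracket[OF that] that by (simp add: d_diff_left L_S algebra_simps)
  define B where "B X Y = L X Y - L Y X" for X Y
  define J where "J X Y Z = B X (B Y Z) + B Y (B Z X) + B Z (B X Y)" for X Y Z
  have J: "J X Y Z = 0" if "X \<in> S" "Y \<in> S" "Z \<in> S" for X Y Z
    using jacobi[OF that] by (simp add: J_def B_def)
  have jac: "re_field W = 0" "im_field W = 0"
    if "W = (cext L X (cext L Y Z - cext L Z Y) - cext L (cext L Y Z - cext L Z Y) X)
      + (cext L Y (cext L Z X - cext L X Z) - cext L (cext L Z X - cext L X Z) Y)
      + (cext L Z (cext L X Y - cext L Y X) - cext L (cext L X Y - cext L Y X) Z)"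
      and XYZ: "re_field X \<in> S" "im_field X \<in> S" "re_field Y \<in> S" "im_field Y \<in> S" "re_field Z \<in> S" "im_field Z \<in> S"
    for W X Y Z
  proof -
    \<comment> \<open>Signs of the trilinear expansion: two imaginary arguments give -1 in the real
      part, three give -1 in the imaginary part.\<close>
    have "re_field W = J (re_field X) (re_field Y) (re_field Z) - J (re_field X) (im_field Y) (im_field Z)
      - J (im_field X) (re_field Y) (im_field Z) - J (im_field X) (im_field Y) (re_field Z)"
      unfolding J_def B_def that(1) using XYZ by (simp add: linear cl; simp add: algebra_simps)
    then show "re_field W = 0" using XYZ by (simp add: J)
    have "im_field W = J (re_field X) (re_field Y) (im_field Z) + J (re_field X) (im_field Y) (re_field Z)
      + J (im_field X) (re_field Y) (re_field Z) - J (im_field X) (im_field Y) (im_field Z)"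
      unfolding J_def B_def that(1) using XYZ by (simp add: linear cl; simp add: algebra_simps)
    then show "im_field W = 0" using XYZ by (simp add: J)
  qed
  show ?thesis
  proof (unfold_locales, goal_cases)
    \<comment> \<open>Goals 20 and 17 are \<open>jacobi\<close> and \<open>d_bracket\<close>,
      counted in the order of the locale assumptions.\<close>
    case (20 X Y Z)
    then show ?case
      by (intro field_eqI) (simp_all only: re_im_field(1,2) mem_Collect_eq jac[OF refl])
  next
    case (17 X Y h)
    then show ?case
      by (intro cfun_eqI; simp add: cext_deriv_def linear cl; simp add: algebra_simps
          dB[of "re_field X" "re_field Y"] dB[of "re_field X" "im_field Y"]
          dB[of "im_field X" "re_field Y"] dB[of "im_field X" "im_field Y"])
  \<comment> \<open>\<open>N_metric\<close> and \<open>L_metric\<close> rewrite the same term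
    \<open>d X (G Y Z)\<close> in different ways, hence two separate attempts.\<close>
  qed ((auto simp: linear cl cext_fun_def cext_deriv_def G_sym N_metric algebra_simps
        intro!: field_eqI cfun_eqI; fail) |
      (auto simp: linear cl cext_fun_def cext_deriv_def L_metric algebra_simps
        intro!: field_eqI cfun_eqI; fail))+
qed

lemma smooth_cvfield_iff: "smooth_cvfield M U Z \<longleftrightarrow> smooth_vfield M U (re_field Z) \<and> smooth_vfield M U (im_field Z)"
  by (simp add: smooth_cvfield_def re_field_def im_field_def)

lemma field_at: "re_vec (Z p) = re_field Z p" "im_vec (Z p) = im_field Z p"
  by (simp_all add: re_field_def im_field_def)

lemma conj_field_re_im [simp]: "re_field (conj_field Z) = re_field Z" "im_field (conj_field Z) = - im_field Z"
  by (auto simp: re_field_def im_field_def conj_field_def re_vec_def im_vec_def fun_eq_iff)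

lemma conj_field_conj_field [simp]: "conj_field (conj_field Z) = Z"
  by (rule field_eqI) simp_all

lemma re_vec_add: "re_vec (\<lambda>f. u f + v f) = (\<lambda>f. re_vec u f + re_vec v f)"
  and im_vec_add: "im_vec (\<lambda>f. u f + v f) = (\<lambda>f. im_vec u f + im_vec v f)"
  by (simp_all add: re_vec_def im_vec_def)

lemma re_vec_scale: "re_vec (\<lambda>f. a * u f) = (\<lambda>f. Re a * re_vec u f - Im a * im_vec u f)"
  and im_vec_scale: "im_vec (\<lambda>f. a * u f) = (\<lambda>f. Re a * im_vec u f + Im a * re_vec u f)"
  by (simp_all add: re_vec_def im_vec_def)

lemmas vec_simps = re_vec_add im_vec_add re_vec_scale im_vec_scale

context smooth_manifold
begin

section \<open>Complexified tangent spaces and linear functionals on them\<close>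

lemma tangent_space_zero: "(\<lambda>f. 0) \<in> tangent_space M p"
  by (simp add: tangent_space_def)

text \<open>The general rule in the shapes of a sum, a difference and a subtracted multiple, which
  do not match explicit coefficients syntactically.\<close>

lemmas tangent_space_lin = tangent_space_comb[of _ _ _ 1 1, simplified]
  tangent_space_comb[of _ _ _ 1 "-1", simplified] tangent_space_comb
  tangent_space_comb[of _ _ _ _ "- b" for b, simplified]

lemma ctangent_space_add:
  "u \<in> ctangent_space M p \<Longrightarrow> v \<in> ctangent_space M p \<Longrightarrow> (\<lambda>f. u f + v f) \<in> ctangent_space M p"
  unfolding ctangent_space_def mem_Collect_eq vec_simps by (intro conjI tangent_space_lin; simp)

lemma ctangent_space_scale: "u \<in> ctangent_space M p \<Longrightarrow> (\<lambda>f. a * u f) \<in> ctangent_space M p"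
  unfolding ctangent_space_def mem_Collect_eq vec_simps by (intro conjI tangent_space_lin; simp)

lemma ctangent_space_zero: "(\<lambda>f. 0) \<in> ctangent_space M p"
  using tangent_space_zero by (simp add: ctangent_space_def re_vec_def im_vec_def)

lemma ctangent_space_sum:
  assumes "finite I" "\<And>i. i \<in> I \<Longrightarrow> u i \<in> ctangent_space M p"
  shows "(\<lambda>f. \<Sum>i\<in>I. c i * u i f) \<in> ctangent_space M p"
  using assms by (induction I) (simp_all add: ctangent_space_zero ctangent_space_add ctangent_space_scale)

text \<open>The functionals that a frame can evaluate. They are total on maps of functions, so
  linearity is asked only on complexified tangent vectors.\<close>

definition clinear_at :: "'a \<Rightarrow> (('a, complex) tvec \<Rightarrow> complex) \<Rightarrow> bool" where
  "clinear_at p \<phi> \<longleftrightarrow>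
     (\<forall>u\<in>ctangent_space M p. \<forall>v\<in>ctangent_space M p. \<phi> (\<lambda>f. u f + v f) = \<phi> u + \<phi> v) \<and>
     (\<forall>u\<in>ctangent_space M p. \<forall>a. \<phi> (\<lambda>f. a * u f) = a * \<phi> u)"

lemma clinear_at_sum:
  assumes "clinear_at p \<phi>" "finite I" "\<And>i. i \<in> I \<Longrightarrow> u i \<in> ctangent_space M p"
  shows "\<phi> (\<lambda>f. \<Sum>i\<in>I. c i * u i f) = (\<Sum>i\<in>I. c i * \<phi> (u i))"
  using assms(2,3)
proof (induction I)
  case empty
  have "\<phi> (\<lambda>f. 0 * (\<lambda>f. 0) f) = 0 * \<phi> (\<lambda>f. 0)"
    using assms(1)[unfolded clinear_at_def, THEN conjunct2, THEN bspec[OF _ ctangent_space_zero]] by (rule spec)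
  then show ?case by simp
next
  case (insert i I)
  then show ?case
    using assms(1) ctangent_space_scale[of "u i" p "c i"] ctangent_space_sum[of I u p c]
    by (simp add: clinear_at_def)
qed

lemma metric_at_comb:
  assumes "riemannian_metric M g" "p \<in> points M"
    "u \<in> tangent_space M p" "v \<in> tangent_space M p" "w \<in> tangent_space M p"
  shows "g p (\<lambda>f. a * u f + b * v f) w = a * g p u w + b * g p v w"
  using assms(1)[unfolded riemannian_metric_def, THEN conjunct1, THEN bspec[OF _ assms(2)],
    THEN bspec[OF _ assms(3)], THEN bspec[OF _ assms(4)], THEN conjunct2, THEN bspec[OF _ assms(5)]]
  by simp

lemmas metric_at_lin = metric_at_comb[of _ _ _ _ _ 1 1, simplified]
  metric_at_comb[of _ _ _ _ _ 1 "-1", simplified] metric_at_comb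
  metric_at_comb[of _ _ _ _ _ _ "- b" for b, simplified]

lemma metric_at_sym:
  assumes "riemannian_metric M g" "p \<in> points M" "u \<in> tangent_space M p" "v \<in> tangent_space M p"
  shows "g p u v = g p v u"
  by (rule assms(1)[unfolded riemannian_metric_def, THEN conjunct1, THEN bspec[OF _ assms(2)],
    THEN bspec[OF _ assms(3)], THEN bspec[OF _ assms(4)], THEN conjunct1])

lemma metric_at_minus_left:
  assumes "riemannian_metric M g" "p \<in> points M" "u \<in> tangent_space M p" "w \<in> tangent_space M p"
  shows "g p (- u) w = - g p u w"
  using metric_at_comb[OF assms(1,2,3,3,4), of "-1" 0] by (simp add: fun_Compl_def)

lemma tangent_space_minus: "u \<in> tangent_space M p \<Longrightarrow> - u \<in> tangent_space M p"
  using tangent_space_comb[of u p u "-1" 0] by (simp add: fun_Compl_def)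

lemma metric_at_minus_right:
  assumes "riemannian_metric M g" "p \<in> points M" "u \<in> tangent_space M p" "w \<in> tangent_space M p"
  shows "g p u (- w) = - g p u w"
  using metric_at_minus_left[OF assms(1,2,4,3)] metric_at_sym[OF assms(1,2,3)] tangent_space_minus[OF assms(4)] assms(4)
  by simp

lemma cext_metric_sym:
  assumes "riemannian_metric M g" "p \<in> points M" "u \<in> ctangent_space M p" "v \<in> ctangent_space M p"
  shows "cext_metric g p u v = cext_metric g p v u"
  using assms(3,4) metric_at_sym[OF assms(1,2)] by (simp add: cext_metric_def ctangent_space_def)

lemma clinear_metric:
  assumes "riemannian_metric M g" "p \<in> points M" "w \<in> ctangent_space M p"
  shows "clinear_at p (\<lambda>v. cext_metric g p v w)"
  unfolding clinear_at_def cext_metric_def vec_simps using assms(3)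
  by (auto simp: ctangent_space_def metric_at_lin[OF assms(1,2)] complex_eq_iff algebra_simps)

text \<open>The direction is a single vector, not a field, so that linearity in it can be stated at
  one point.\<close>

definition cov_at :: "'a connection \<Rightarrow> 'a \<Rightarrow> ('a, complex) tvec \<Rightarrow> ('a, complex) vfield \<Rightarrow> ('a, complex) tvec" where
  "cov_at D p v Y = (\<lambda>f. Complex (D p (re_vec v) (re_field Y) f - D p (im_vec v) (im_field Y) f)
     (D p (re_vec v) (im_field Y) f + D p (im_vec v) (re_field Y) f))"

lemma cext_cov_at: "cext (cov D) X Y p = cov_at D p (X p) Y"
  by (simp add: cov_at_def cext_def Let_def cov_def re_field_def im_field_def)

lemma cov_left_comb:
  assumes "connection M D" "v \<in> tangent_space M q" "w \<in> tangent_space M q" "smooth_vfield M U Z" "q \<in> U"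
  shows "D q (\<lambda>f. a * v f + b * w f) Z = (\<lambda>f. a * D q v Z f + b * D q w Z f)"
    and "D q v Z \<in> tangent_space M q"
proof -
  note c = assms(1)[unfolded connection_def, THEN spec, THEN spec, THEN mp, OF assms(4), THEN conjunct1,
    THEN bspec[OF _ assms(5)], THEN bspec[OF _ assms(2)]]
  show "D q (\<lambda>f. a * v f + b * w f) Z = (\<lambda>f. a * D q v Z f + b * D q w Z f)"
    by (rule c[THEN conjunct2, THEN conjunct1, THEN bspec[OF _ assms(3)], THEN spec, THEN spec])
  show "D q v Z \<in> tangent_space M q" by (rule c[THEN conjunct1])
qed

lemmas cov_left_lin = cov_left_comb(1)[of _ _ _ _ _ _ 1 1, simplified]
  cov_left_comb(1)[of _ _ _ _ _ _ 1 "-1", simplified] cov_left_comb(1)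
  cov_left_comb(1)[of _ _ _ _ _ _ _ "- b" for b, simplified]

lemma cov_at_ctangent:
  assumes "connection M D" "v \<in> ctangent_space M q" "smooth_cvfield M U Y" "q \<in> U"
  shows "cov_at D q v Y \<in> ctangent_space M q"
proof -
  have Y: "smooth_vfield M U (re_field Y)" "smooth_vfield M U (im_field Y)"
    using assms(3) by (simp_all add: smooth_cvfield_iff)
  have v: "re_vec v \<in> tangent_space M q" "im_vec v \<in> tangent_space M q"
    using assms(2) by (simp_all add: ctangent_space_def)
  have "re_vec (cov_at D q v Y) = (\<lambda>f. D q (re_vec v) (re_field Y) f - D q (im_vec v) (im_field Y) f)"
    "im_vec (cov_at D q v Y) = (\<lambda>f. D q (re_vec v) (im_field Y) f + D q (im_vec v) (re_field Y) f)"
    by (simp_all add: cov_at_def re_vec_def im_vec_def)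
  then show ?thesis
    unfolding ctangent_space_def mem_Collect_eq
    using cov_left_comb(2)[OF assms(1) _ _ _ assms(4)] Y v by (simp add: tangent_space_lin)
qed

lemma cov_at_add:
  assumes "connection M D" "u \<in> ctangent_space M q" "v \<in> ctangent_space M q" "smooth_cvfield M U Y" "q \<in> U"
  shows "cov_at D q (\<lambda>f. u f + v f) Y = (\<lambda>f. cov_at D q u Y f + cov_at D q v Y f)"
    and "cov_at D q (\<lambda>f. a * u f) Y = (\<lambda>f. a * cov_at D q u Y f)"
  using assms(2-4) unfolding cov_at_def vec_simps
  by (simp_all add: cov_left_lin[OF assms(1) _ _ _ assms(5)] ctangent_space_def smooth_cvfield_iff
      fun_eq_iff complex_eq_iff) (simp_all add: algebra_simps)

lemma clinear_cov_at:
  assumes "riemannian_metric M g" "connection M D" "smooth_cvfield M U Y" "q \<in> U" "w \<in> ctangent_space M q"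
  shows "clinear_at q (\<lambda>v. cext_metric g q (cov_at D q v Y) w)"
proof -
  have q: "q \<in> points M" using assms(3,4) by (auto simp: smooth_cvfield_iff smooth_vfield_def)
  show ?thesis
    using clinear_metric[OF assms(1) q assms(5)] cov_at_ctangent[OF assms(2) _ assms(3,4)]
    by (simp add: clinear_at_def cov_at_add[OF assms(2) _ _ assms(3,4)])
qed

end

section \<open>Almost Hermitian manifolds with a unitary frame\<close>

text \<open>For a unitary frame the vector with index \<open>bar A\<close> is dual to the one with
  index \<open>A\<close> under the complex bilinear metric.\<close>

fun bar :: "frame_index \<Rightarrow> frame_index" where
  "bar (Hol i) = Bar i"
| "bar (Bar i) = Hol i"

lemma bar_bar [simp]: "bar (bar A) = A"
  by (cases A) simp_all

lemma frame_indices_iff [simp]: "Hol i \<in> frame_indices n \<longleftrightarrow> i \<in> {1..n}" "Bar i \<in> frame_indices n \<longleftrightarrow> i \<in> {1..n}"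
  by (auto simp: frame_indices_def)

lemma bar_frame_indices [simp]: "bar A \<in> frame_indices n \<longleftrightarrow> A \<in> frame_indices n"
  by (cases A) (simp_all del: atLeastAtMost_iff)

lemma finite_frame_indices [simp]: "finite (frame_indices n)"
  by (simp add: frame_indices_def)

lemma sum_frame_indices: "(\<Sum>A\<in>frame_indices n. h A) = (\<Sum>i=1..n. h (Hol i)) + (\<Sum>i=1..n. h (Bar i))"
  unfolding frame_indices_def by (subst sum.union_disjoint) (auto simp: sum.reindex inj_on_def)

locale hermitian_frame =
  fixes n :: nat
    and M :: "('a::{t2_space, second_countable_topology}, 'e::euclidean_space) atlas"
    and J :: "'a \<Rightarrow> ('a, real) tvec \<Rightarrow> ('a, real) tvec"
    and g :: "'a \<Rightarrow> ('a, real) tvec \<Rightarrow> ('a, real) tvec \<Rightarrow> real"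
    and D DL :: "'a connection"
    and e :: "nat \<Rightarrow> ('a, complex) vfield"
    and U :: "'a set"
  assumes ahm: "almost_hermitian_manifold n M J g"
    and canonical: "canonical_connection M J g D"
    and levi_civita: "levi_civita_connection M g DL"
    and frame: "unitary_10_frame n M J g U e"

sublocale hermitian_frame \<subseteq> smooth_manifold
  using ahm by unfold_locales (simp add: almost_hermitian_manifold_def)

context hermitian_frame
begin

lemma g: "riemannian_metric M g" and J: "almost_complex_structure M J"
  using ahm by (simp_all add: almost_hermitian_manifold_def)

lemma D: "connection M D" "metric_connection M g D" "complex_connection M J D"
  using canonical by (simp_all add: canonical_connection_def)

lemma DL: "connection M DL" "metric_connection M g DL"
  using levi_civita by (simp_all add: levi_civita_connection_def)

text \<open>The real model keeps the prefix \<open>real\<close> because J and conjugation are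
  treated on real and imaginary parts; unprefixed facts belong to the complexification.\<close>

sublocale real: two_metric_connections "{X. smooth_vfield M U X}" "{h. smooth_fun M U h}"
  "\<lambda>X Y. cutoff U (cov D X Y)" "\<lambda>X Y. cutoff U (cov DL X Y)"
  "\<lambda>X Y. cutoff U (\<lambda>q. g q (X q) (Y q))" "\<lambda>X h. cutoff U (\<lambda>q. X q h)"
  by (rule real_fields_model[OF g D(1,2) levi_civita])

abbreviation cN where "cN \<equiv> cext (\<lambda>X Y. cutoff U (cov D X Y))"
abbreviation cL where "cL \<equiv> cext (\<lambda>X Y. cutoff U (cov DL X Y))"
abbreviation cG where "cG \<equiv> cext_fun (\<lambda>X Y. cutoff U (\<lambda>q. g q (X q) (Y q)))"

sublocale two_metric_connections "{Z. smooth_cvfield M U Z}"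
  "{h. Re \<circ> h \<in> {h. smooth_fun M U h} \<and> Im \<circ> h \<in> {h. smooth_fun M U h}}"
  cN cL cG "cext_deriv (\<lambda>X h. cutoff U (\<lambda>q. X q h))"
  using complexified_model[OF real.two_metric_connections_axioms] by (simp add: smooth_cvfield_iff)

abbreviation S where "S \<equiv> {Z. smooth_cvfield M U Z}"

section \<open>Cut-off operations compared with the given ones on \<open>U\<close>\<close>

lemma cext_cutoff_notin [simp]: "q \<notin> U \<Longrightarrow> cext (\<lambda>X Y. cutoff U (h X Y)) Z W q = 0"
  by (auto simp: cext_def Let_def complex_eq_iff)

lemma cext_cutoff [simp]: "q \<in> U \<Longrightarrow> cext (\<lambda>X Y. cutoff U (h X Y)) Z W q = cext h Z W q"
  by (auto simp: cext_def Let_def complex_eq_iff)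

lemma cG_at [simp]: "q \<in> U \<Longrightarrow> cG Z W q = cext_metric g q (Z q) (W q)"
  by (simp add: cext_fun_def cext_metric_def cfun_def field_at)

lemma bracket_at:
  assumes "X \<in> S" "Y \<in> S" "q \<in> U"
  shows "cext (lie_bracket M) X Y q = lie X Y q"
proof
  fix f
  have "smooth_vfield M U (re_field X)" "smooth_vfield M U (im_field X)"
    "smooth_vfield M U (re_field Y)" "smooth_vfield M U (im_field Y)"
    using assms by (simp_all add: smooth_cvfield_iff)
  then show "cext (lie_bracket M) X Y q f = lie X Y q f"
    using assms(3) by (simp add: lie_def cext_def Let_def complex_eq_iff field_at lie_bracket_at[OF levi_civita])
qed

lemma cov_at_cong_left: "X q = X' q \<Longrightarrow> cext (cov D') X Y q = cext (cov D') X' Y q"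
  by (simp add: cext_def Let_def cov_def)

lemma re_im_cong: "X q = X' q \<Longrightarrow> re_field X q = re_field X' q" "X q = X' q \<Longrightarrow> im_field X q = im_field X' q"
  by (simp_all add: re_field_def im_field_def)

lemma cov_at_cong_right:
  assumes "connection M D'" "X \<in> S" "Y \<in> S" "\<And>q. q \<in> U \<Longrightarrow> Y q = Y' q" "q \<in> U"
  shows "cext (cov D') X Y q = cext (cov D') X Y' q"
proof -
  have "cov D' P (re_field Y) q = cov D' P (re_field Y') q"
    "cov D' P (im_field Y) q = cov D' P (im_field Y') q" if P: "smooth_vfield M U P" for P
  proof -
    have Y: "smooth_vfield M U (re_field Y)" "smooth_vfield M U (im_field Y)"
      using assms(3) by (simp_all add: smooth_cvfield_iff)
    show "cov D' P (re_field Y) q = cov D' P (re_field Y') q"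
      by (rule cov_cong_right[OF assms(1) P Y(1) _ assms(5)]) (rule re_im_cong(1)[where q = "_ :: 'a", OF assms(4)])
    show "cov D' P (im_field Y) q = cov D' P (im_field Y') q"
      by (rule cov_cong_right[OF assms(1) P Y(2) _ assms(5)]) (rule re_im_cong(2)[where q = "_ :: 'a", OF assms(4)])
  qed
  then show ?thesis
    using assms(2) by (simp add: cext_def Let_def field_at smooth_cvfield_iff)
qed

lemma cov_S: "X \<in> S \<Longrightarrow> Y \<in> S \<Longrightarrow> cext (cov D) X Y \<in> S"
  using cov_smooth[OF D(1)] by (simp add: smooth_cvfield_iff smooth_vfield_add smooth_vfield_diff)

lemma torsion_at:
  assumes "X \<in> S" "Y \<in> S" "q \<in> U"
  shows "ctorsion M D X Y q = tor X Y q"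
  using assms by (simp add: torsion_def tor_def bracket_at fun_diff_def)

text \<open>Serves \<open>cov_torsion_at\<close>, where torsions are taken of derivatives that agree
  with their cut-off versions on \<open>U\<close> only.\<close>

lemma tor_cong:
  assumes "X \<in> S" "Y \<in> S" "\<And>q. q \<in> U \<Longrightarrow> X q = X' q" "\<And>q. q \<in> U \<Longrightarrow> Y q = Y' q"
  shows "tor X Y = tor X' Y'"
proof
  fix q
  have "cext (cov D') X Y q = cext (cov D') X' Y' q" "cext (cov D') Y X q = cext (cov D') Y' X' q"
    if "q \<in> U" "connection M D'" for D'
    using cov_at_cong_right[OF that(2) assms(1,2,4) that(1)] cov_at_cong_right[OF that(2) assms(2,1,3) that(1)]
      cov_at_cong_left[of X q X'] cov_at_cong_left[of Y q Y'] assms(3,4) that(1) by metis+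
  then show "tor X Y q = tor X' Y' q"
    using D(1) DL(1) by (cases "q \<in> U") (simp_all add: tor_def lie_def)
qed

lemma curvature_at:
  assumes [simp]: "X \<in> S" "Y \<in> S" "Z \<in> S" "q \<in> U"
  shows "ccurvature M D X Y Z q = curv X Y Z q" "ccurvature M DL X Y Z q = curvL X Y Z q"
proof -
  \<comment> \<open>The bracket enters only as a direction, so its value at \<open>q\<close>
    suffices. The inner derivatives are differentiated again and must be replaced on all of
    \<open>U\<close>.\<close>
  have "cext (cov D) (cext (lie_bracket M) X Y) Z q = cext (cov D) (lie X Y) Z q"
    "cext (cov DL) (cext (lie_bracket M) X Y) Z q = cext (cov DL) (lie X Y) Z q"
    by (simp_all only: assms bracket_at cov_at_cong_left[of "cext (lie_bracket M) X Y" q "lie X Y"])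
  moreover have "cext (cov D) P (cN Q Z) q = cext (cov D) P (cext (cov D) Q Z) q"
    if "P \<in> S" "Q \<in> S" for P Q
    by (rule cov_at_cong_right[OF D(1) that(1) N_S[OF that(2) assms(3)] _ assms(4)]) (rule cext_cutoff)
  moreover have "cext (cov DL) P (cL Q Z) q = cext (cov DL) P (cext (cov DL) Q Z) q"
    if "P \<in> S" "Q \<in> S" for P Q
    by (rule cov_at_cong_right[OF DL(1) that(1) L_S[OF that(2) assms(3)] _ assms(4)]) (rule cext_cutoff)
  ultimately show "ccurvature M D X Y Z q = curv X Y Z q" "ccurvature M DL X Y Z q = curvL X Y Z q"
    using assms(1,2) by (simp_all only: curv_def curvL_def curvature_def fun_diff_def cext_cutoff[OF assms(4)])
qed

lemma cov_torsion_at: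
  assumes [simp]: "X \<in> S" "Y \<in> S" "Z \<in> S" "q \<in> U"
  shows "ccov_torsion M D Z X Y q = dtor Z X Y q"
proof -
  have "cext (cov D) Z (ctorsion M D X Y) q = cext (cov D) Z (tor X Y) q"
    by (rule cov_at_cong_right[symmetric, OF D(1)]) (simp_all only: assms tor_S torsion_at)
  moreover have "ctorsion M D (cext (cov D) Z X) Y q = tor (cN Z X) Y q"
    by (simp only: torsion_at cov_S assms) (rule fun_cong[OF tor_cong]; simp only: assms cov_S cext_cutoff)
  moreover have "ctorsion M D X (cext (cov D) Z Y) q = tor X (cN Z Y) q"
    by (simp only: torsion_at cov_S assms) (rule fun_cong[OF tor_cong]; simp only: assms cov_S cext_cutoff)
  ultimately show ?thesis
    by (simp only: cov_torsion_def dtor_def fun_diff_def cext_cutoff[OF assms(4)])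
qed

lemma U_points: "q \<in> U \<Longrightarrow> q \<in> points M"
  using frame by (auto simp: unitary_10_frame_def)

lemma S_ctangent: "X \<in> S \<Longrightarrow> q \<in> U \<Longrightarrow> X q \<in> ctangent_space M q"
  using smooth_vfield_tangent[of U "re_field X" q] smooth_vfield_tangent[of U "im_field X" q]
  by (simp add: smooth_cvfield_iff ctangent_space_def field_at)

lemma conj_S: "X \<in> S \<Longrightarrow> conj_field X \<in> S"
  using real.minus_S by (simp add: smooth_cvfield_iff)

section \<open>Types of fields and vanishing of mixed terms\<close>

lemma J_props:
  assumes "q \<in> U" "u \<in> tangent_space M q"
  shows J_tangent: "J q u \<in> tangent_space M q"
    and J_J: "J q (J q u) = - u"
    and J_comb: "v \<in> tangent_space M q \<Longrightarrow> J q (\<lambda>f. a * u f + b * v f) = (\<lambda>f. a * J q u f + b * J q v f)"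
  using J[unfolded almost_complex_structure_def, THEN conjunct1, THEN bspec[OF _ U_points[OF assms(1)]],
      THEN bspec[OF _ assms(2)]]
  by (auto simp: fun_eq_iff)

lemma J_isometry:
  assumes "q \<in> U" "u \<in> tangent_space M q" "v \<in> tangent_space M q"
  shows "g q (J q u) (J q v) = g q u v"
  using ahm assms(2,3) U_points[OF assms(1)] by (simp add: almost_hermitian_manifold_def)

lemma J_add:
  assumes "q \<in> U" "u \<in> tangent_space M q" "v \<in> tangent_space M q"
  shows "J q (u + v) = J q u + J q v"
  using J_comb[OF assms(1,2,3), of 1 1] by (simp add: plus_fun_def)

lemma J_diff:
  assumes "q \<in> U" "u \<in> tangent_space M q" "v \<in> tangent_space M q"
  shows "J q (u - v) = J q u - J q v"
  using J_comb[OF assms(1,2,3), of 1 "-1"] by (simp add: fun_diff_def)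

lemma cext_J_eq_iff:
  "cext_J J q v = (\<lambda>f. \<i> * v f) \<longleftrightarrow> J q (re_vec v) = - im_vec v \<and> J q (im_vec v) = re_vec v"
  by (auto simp: cext_J_def fun_eq_iff complex_eq_iff re_vec_def im_vec_def)

lemma T10_iff: "v \<in> T10 M J q \<longleftrightarrow>
    v \<in> ctangent_space M q \<and> J q (re_vec v) = - im_vec v \<and> J q (im_vec v) = re_vec v"
  by (simp add: T10_def cext_J_eq_iff)

text \<open>In complex form, <v,w> = <Jv,Jw> = i^2 <v,w>; the proof carries this out on real and
  imaginary parts.\<close>

lemma T10_isotropic:
  assumes "q \<in> U" "v \<in> T10 M J q" "w \<in> T10 M J q"
  shows "cext_metric g q v w = 0"
proof -
  have t: "re_vec v \<in> tangent_space M q" "im_vec v \<in> tangent_space M q"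
    "re_vec w \<in> tangent_space M q" "im_vec w \<in> tangent_space M q"
    using assms(2,3) by (simp_all add: T10_iff ctangent_space_def)
  note neg = metric_at_minus_left[OF g U_points[OF assms(1)]] metric_at_minus_right[OF g U_points[OF assms(1)]]
    tangent_space_minus
  have "g q (re_vec v) (re_vec w) = g q (im_vec v) (im_vec w)"
    using J_isometry[OF assms(1) t(1,3)] assms(2,3) t by (simp add: T10_iff neg)
  moreover have "g q (re_vec v) (im_vec w) = - g q (im_vec v) (re_vec w)"
    using J_isometry[OF assms(1) t(1,4)] assms(2,3) t by (simp add: T10_iff neg)
  ultimately show ?thesis by (simp add: cext_metric_def complex_eq_iff)
qed

abbreviation field_10 where "field_10 Z \<equiv> smooth_10_field M J U Z"

lemma field_10_S: "field_10 Z \<Longrightarrow> Z \<in> S"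
  by (simp add: smooth_10_field_def)

text \<open>\<open>D\<close> commutes with J, so the relations between real and imaginary part that
  express type (1,0) survive differentiation.\<close>

lemma N_10:
  assumes Z: "Z \<in> S" and W: "field_10 W"
  shows "field_10 (cN Z W)"
proof -
  have WS: "W \<in> S" using W by (rule field_10_S)
  have sW: "smooth_vfield M U (re_field W)" "smooth_vfield M U (im_field W)"
    using WS by (simp_all add: smooth_cvfield_iff)
  have "cN Z W q \<in> T10 M J q" if q: "q \<in> U" for q
  proof -
    have JW: "J r (re_field W r) = (- im_field W) r" "J r (im_field W r) = re_field W r" if "r \<in> U" for r
      using W that by (simp_all add: smooth_10_field_def T10_iff field_at)
    have Jcov: "J q (cov D P (re_field W) q) = - cov D P (im_field W) q"
      "J q (cov D P (im_field W) q) = cov D P (re_field W) q" if P: "smooth_vfield M U P" for P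
    proof -
      have Jsm: "smooth_vfield M U (\<lambda>r. J r (Y r))" if "smooth_vfield M U Y" for Y
        by (rule J[unfolded almost_complex_structure_def, THEN conjunct2, THEN spec, THEN spec, THEN mp, OF that])
      have JN: "J q (cov D P Y q) = cov D P (\<lambda>r. J r (Y r)) q" if "smooth_vfield M U Y" for Y
        by (rule D(3)[unfolded complex_connection_def, THEN spec, THEN spec, THEN spec, THEN mp, THEN mp,
            OF P that, THEN bspec[OF _ q], symmetric])
      have "cov D P (\<lambda>r. J r (re_field W r)) q = cov D P (- im_field W) q"
        by (rule cov_cong_right[OF D(1) P Jsm[OF sW(1)] JW(1) q])
      then show "J q (cov D P (re_field W) q) = - cov D P (im_field W) q"
        using JN[OF sW(1)] real.N_minus_right[of P "im_field W"] P sW q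
        by (auto dest: fun_cong[where x = q])
      have "cov D P (\<lambda>r. J r (im_field W r)) q = cov D P (re_field W) q"
        by (rule cov_cong_right[OF D(1) P Jsm[OF sW(2)] JW(2) q])
      then show "J q (cov D P (im_field W) q) = cov D P (re_field W) q"
        using JN[OF sW(2)] by simp
    qed
    have sZ: "smooth_vfield M U (re_field Z)" "smooth_vfield M U (im_field Z)"
      using Z by (simp_all add: smooth_cvfield_iff)
    note t = smooth_vfield_tangent[OF cov_smooth[OF D(1)] q]
    show ?thesis
      using S_ctangent[OF N_S[OF Z WS] q] q
      unfolding T10_iff field_at re_im_field
      by (simp add: J_add J_diff t sZ sW Jcov)
  qed
  then show ?thesis using N_S[OF Z WS] by (simp add: smooth_10_field_def)
qed

lemma conj_N:
  assumes "Z \<in> S" "W \<in> S"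
  shows "conj_field (cN Z W) = cN (conj_field Z) (conj_field W)"
  using assms by (intro field_eqI) (simp_all add: smooth_cvfield_iff real.N_minus_left real.N_minus_right real.minus_S[simplified])

lemma N_01:
  assumes "Z \<in> S" "field_10 (conj_field W)"
  shows "field_10 (conj_field (cN Z W))"
proof -
  have "W \<in> S" using conj_S[OF field_10_S[OF assms(2)]] by simp
  then show ?thesis using N_10[OF conj_S[OF assms(1)] assms(2)] by (simp only: conj_N[OF assms(1)])
qed

lemma cG_notin: "q \<notin> U \<Longrightarrow> cG X Y q = 0"
  by (simp add: cext_fun_def cfun_def complex_eq_iff)

lemma G_10_10: "field_10 X \<Longrightarrow> field_10 Y \<Longrightarrow> cG X Y = 0"
proof
  fix q
  assume "field_10 X" "field_10 Y"
  then show "cG X Y q = 0 q"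
    by (cases "q \<in> U") (simp_all add: T10_isotropic smooth_10_field_def cG_notin)
qed

text \<open>Type (0,1) of \<open>Y\<close> is encoded as type (1,0) of its conjugate, to which the
  defining property of the canonical connection is applied.\<close>

lemma tor_10_01:
  assumes "field_10 X" "field_10 (conj_field Y)"
  shows "tor X Y = 0"
proof
  fix q
  have S: "X \<in> S" "Y \<in> S" using field_10_S[OF assms(1)] conj_S[OF field_10_S[OF assms(2)]] by simp_all
  show "tor X Y q = 0 q"
  proof (cases "q \<in> U")
    case True
    have "ctorsion M D X (conj_field (conj_field Y)) q = (\<lambda>f. 0)"
      by (rule canonical[unfolded canonical_connection_def, THEN conjunct2, THEN conjunct2, THEN conjunct2,
          THEN spec, THEN spec, THEN spec, THEN mp, THEN mp, OF assms, THEN bspec[OF _ True]])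
    then show ?thesis using torsion_at[OF S True] by (simp add: zero_fun_def)
  next
    case False
    then show ?thesis by (simp add: tor_def lie_def)
  qed
qed

lemma tor_01_10: "field_10 (conj_field X) \<Longrightarrow> field_10 Y \<Longrightarrow> tor X Y = 0"
  using tor_10_01[of Y X] tor_antisym[of X Y] by simp

text \<open>Differentiation preserves both types, so all three torsions inside \<open>dtor\<close>
  are mixed.\<close>

lemma dtor_10_01:
  assumes "Z \<in> S" "field_10 X" "field_10 (conj_field Y)"
  shows "dtor Z X Y = 0" "dtor Z Y X = 0"
  using assms N_10[OF assms(1,2)] N_01[OF assms(1,3)]
  by (simp_all only: dtor_def tor_10_01 tor_01_10 N_zero_right) simp_all

text \<open>Curvature keeps the type of \<open>Z\<close>, and (1,0)-fields are isotropic.\<close>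

lemma G_curv_10:
  assumes "X \<in> S" "Y \<in> S" "field_10 Z" "field_10 W"
  shows "cG (curv X Y Z) W = 0"
  unfolding curv_def using assms
  by (simp only: G_diff_left S_diff N_S lie_S field_10_S G_10_10 N_10) simp

section \<open>Expansion in the unitary frame\<close>

abbreviation E where "E \<equiv> frame_field e"
abbreviation I where "I \<equiv> frame_indices n"

lemma e_10: "i \<in> {1..n} \<Longrightarrow> field_10 (e i)"
  using frame unfolding unitary_10_frame_def by blast

lemma E_S: "A \<in> I \<Longrightarrow> E A \<in> S"
  by (cases A) (simp_all only: frame_field.simps frame_indices_iff conj_S e_10 field_10_S)

lemma E_ctangent: "A \<in> I \<Longrightarrow> q \<in> U \<Longrightarrow> E A q \<in> ctangent_space M q"
  using E_S S_ctangent by blast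

lemma metric_conj:
  assumes "q \<in> U" "X \<in> S" "Y \<in> S"
  shows "cext_metric g q (conj_field X q) (conj_field Y q) = cnj (cext_metric g q (X q) (Y q))"
  using S_ctangent[OF assms(2,1)] S_ctangent[OF assms(3,1)]
  by (simp add: cext_metric_def field_at ctangent_space_def complex_eq_iff tangent_space_minus
      metric_at_minus_left[OF g U_points[OF assms(1)]] metric_at_minus_right[OF g U_points[OF assms(1)]])

lemma metric_frame:
  assumes "q \<in> U" "A \<in> I" "B \<in> I"
  shows "cext_metric g q (E A q) (E B q) = (if B = bar A then 1 else 0)"
proof -
  have hb: "cext_metric g q (e i q) (conj_field (e j) q) = (if i = j then 1 else 0)"
    if "i \<in> {1..n}" "j \<in> {1..n}" for i j
    using frame assms(1) that unfolding unitary_10_frame_def by blast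
  have hh: "cext_metric g q (e i q) (e j q) = 0" if "i \<in> {1..n}" "j \<in> {1..n}" for i j
    using e_10 that assms(1) by (intro T10_isotropic) (simp_all add: smooth_10_field_def del: atLeastAtMost_iff)
  have bb: "cext_metric g q (conj_field (e i) q) (conj_field (e j) q) = 0" if "i \<in> {1..n}" "j \<in> {1..n}" for i j
    by (simp only: metric_conj[OF assms(1) field_10_S[OF e_10[OF that(1)]] field_10_S[OF e_10[OF that(2)]]] hh[OF that]) simp
  have bh: "cext_metric g q (conj_field (e i) q) (e j q) = (if i = j then 1 else 0)" if "i \<in> {1..n}" "j \<in> {1..n}" for i j
    using cext_metric_sym[OF g U_points[OF assms(1)] E_ctangent[of "Bar i" q] E_ctangent[of "Hol j" q]] hb[OF that(2,1)] that assms(1)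
    by (simp del: atLeastAtMost_iff)
  show ?thesis
    using assms(2,3) by (cases A; cases B) (simp_all add: hb hh bb bh del: atLeastAtMost_iff)
qed

lemma coeff_eq_metric:
  assumes "q \<in> U" "v = (\<lambda>f. \<Sum>A\<in>I. c A * E A q f)" "A \<in> I"
  shows "c A = cext_metric g q v (E (bar A) q)"
proof -
  have "cext_metric g q v (E (bar A) q) = (\<Sum>B\<in>I. c B * cext_metric g q (E B q) (E (bar A) q))"
    unfolding assms(2)
    by (rule clinear_at_sum[OF clinear_metric[OF g U_points[OF assms(1)]]])
      (simp_all add: E_ctangent assms(1,3))
  also have "\<dots> = (\<Sum>B\<in>I. if B = A then c B else 0)"
    using assms(1,3) by (intro sum.cong refl) (auto simp: metric_frame dest: arg_cong[where f = bar])
  also have "\<dots> = c A" using assms(3) by simp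
  finally show ?thesis by simp
qed

lemma frame_span:
  assumes q: "q \<in> U" and v: "v \<in> ctangent_space M q"
  shows "\<exists>c. v = (\<lambda>f. \<Sum>A\<in>I. c A * E A q f)"
proof -
  define a where "a = re_vec v"
  define b where "b = im_vec v"
  have ab: "a \<in> tangent_space M q" "b \<in> tangent_space M q"
    using v by (simp_all add: a_def b_def ctangent_space_def)
  note Jab = J_tangent[OF q ab(1)] J_tangent[OF q ab(2)]
  \<comment> \<open>\<open>w\<close> is (v - iJv)/2, the (1,0)-part of \<open>v\<close>, and
    \<open>u\<close> is the conjugate of the (0,1)-part (v + iJv)/2.\<close>
  define w where "w = (\<lambda>f. Complex (1/2 * a f + 1/2 * J q b f) (1/2 * b f + (-1/2) * J q a f))"
  define u where "u = (\<lambda>f. Complex (1/2 * a f + (-1/2) * J q b f) ((-1/2) * b f + (-1/2) * J q a f))"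
  have w: "re_vec w = (\<lambda>f. 1/2 * a f + 1/2 * J q b f)" "im_vec w = (\<lambda>f. 1/2 * b f + (-1/2) * J q a f)"
    by (simp_all add: w_def re_vec_def im_vec_def)
  have u: "re_vec u = (\<lambda>f. 1/2 * a f + (-1/2) * J q b f)" "im_vec u = (\<lambda>f. (-1/2) * b f + (-1/2) * J q a f)"
    by (simp_all add: u_def re_vec_def im_vec_def)
  have span: "\<exists>c. x = (\<lambda>f. \<Sum>i=1..n. c i * e i q f)" if "x \<in> T10 M J q" for x
    using frame that q unfolding unitary_10_frame_def by blast
  have "w \<in> T10 M J q"
    unfolding T10_iff ctangent_space_def mem_Collect_eq w J_comb[OF q ab(1) Jab(2)] J_comb[OF q ab(2) Jab(1)]
    by (intro conjI tangent_space_comb ab Jab) (simp_all add: J_J[OF q] ab fun_eq_iff)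
  then obtain c where c: "w = (\<lambda>f. \<Sum>i=1..n. c i * e i q f)" using span by blast
  have "u \<in> T10 M J q"
    unfolding T10_iff ctangent_space_def mem_Collect_eq u J_comb[OF q ab(1) Jab(2)] J_comb[OF q ab(2) Jab(1)]
    by (intro conjI tangent_space_comb ab Jab) (simp_all add: J_J[OF q] ab fun_eq_iff)
  then obtain d where d: "u = (\<lambda>f. \<Sum>i=1..n. d i * e i q f)" using span by blast
  have "v = (\<lambda>f. w f + cnj (u f))"
    by (auto simp: w_def u_def a_def b_def re_vec_def im_vec_def complex_eq_iff)
  also have "\<dots> = (\<lambda>f. \<Sum>A\<in>I. (case A of Hol i \<Rightarrow> c i | Bar i \<Rightarrow> cnj (d i)) * E A q f)"
    unfolding c d by (simp add: sum_frame_indices conj_field_def)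
  finally show ?thesis by blast
qed

lemma frame_expansion:
  assumes "q \<in> U" "v \<in> ctangent_space M q"
  shows "v = (\<lambda>f. \<Sum>A\<in>I. cext_metric g q v (E (bar A) q) * E A q f)"
proof -
  obtain c where c: "v = (\<lambda>f. \<Sum>A\<in>I. c A * E A q f)" using frame_span[OF assms] by blast
  have "(\<lambda>f. \<Sum>A\<in>I. c A * E A q f) = (\<lambda>f. \<Sum>A\<in>I. cext_metric g q v (E (bar A) q) * E A q f)"
    by (intro ext sum.cong refl) (simp only: coeff_eq_metric[OF assms(1) c])
  with c show ?thesis by simp
qed

lemma component_eq:
  assumes "q \<in> U" "v \<in> ctangent_space M q" "A \<in> I"
  shows "component n e q v A = cext_metric g q v (E (bar A) q)"
proof -
  \<comment> \<open>The extension by 0 matches the normalisation that makes coefficients unique in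
    \<open>component\<close>.\<close>
  define c where "c A = (if A \<in> I then cext_metric g q v (E (bar A) q) else 0)" for A
  have "component n e q v = c"
    unfolding component_def
  proof (rule the_equality)
    have "(\<lambda>f. \<Sum>A\<in>I. cext_metric g q v (E (bar A) q) * E A q f) = (\<lambda>f. \<Sum>A\<in>I. c A * E A q f)"
      by (intro ext sum.cong refl) (simp add: c_def)
    then show "(\<forall>A. A \<notin> I \<longrightarrow> c A = 0) \<and> v = (\<lambda>f. \<Sum>A\<in>I. c A * E A q f)"
      using frame_expansion[OF assms(1,2)] by (simp add: c_def)
    fix d
    assume d: "(\<forall>A. A \<notin> I \<longrightarrow> d A = 0) \<and> v = (\<lambda>f. \<Sum>A\<in>I. d A * E A q f)"
    show "d = c"
    proof
      show "d A = c A" for A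
        using d coeff_eq_metric[OF assms(1) conjunct2[OF d], of A] by (simp add: c_def)
    qed
  qed
  then show ?thesis using assms(3) by (simp add: c_def)
qed

lemma clinear_frame:
  assumes "q \<in> U" "v \<in> ctangent_space M q" "clinear_at q \<phi>"
  shows "\<phi> v = (\<Sum>A\<in>I. cext_metric g q v (E (bar A) q) * \<phi> (E A q))"
proof -
  have "\<phi> v = \<phi> (\<lambda>f. \<Sum>A\<in>I. cext_metric g q v (E (bar A) q) * E A q f)"
    using frame_expansion[OF assms(1,2)] by simp
  also have "\<dots> = (\<Sum>A\<in>I. cext_metric g q v (E (bar A) q) * \<phi> (E A q))"
    by (rule clinear_at_sum[OF assms(3)]) (simp_all add: E_ctangent assms(1))
  finally show ?thesis .
qed

text \<open>The metric is complex bilinear, so the dual indices \<open>bar A\<close> and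
  \<open>A\<close> take the place of a conjugation.\<close>

lemma parseval:
  assumes "q \<in> U" "X \<in> S" "Y \<in> S"
  shows "cG X Y q = (\<Sum>A\<in>I. cG X (E (bar A)) q * cG Y (E A) q)"
proof -
  have "cext_metric g q (X q) (Y q) = (\<Sum>A\<in>I. cext_metric g q (X q) (E (bar A) q) * cext_metric g q (E A q) (Y q))"
    using clinear_frame[OF assms(1) S_ctangent[OF assms(2,1)] clinear_metric[OF g U_points[OF assms(1)] S_ctangent[OF assms(3,1)]]] .
  also have "\<dots> = (\<Sum>A\<in>I. cext_metric g q (X q) (E (bar A) q) * cext_metric g q (Y q) (E A q))"
    using cext_metric_sym[OF g U_points[OF assms(1)] E_ctangent[OF _ assms(1)] S_ctangent[OF assms(3,1)]]
    by (intro sum.cong refl) simp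
  finally show ?thesis using assms(1) by simp
qed

lemma cG_contor_left:
  assumes "X \<in> S" "Y \<in> S" "Z \<in> S" "q \<in> U"
  shows "cG (contor X Y) Z q = cext_metric g q (cov_at DL q (X q) Y) (Z q) - cext_metric g q (cov_at D q (X q) Y) (Z q)"
  using fun_cong[OF G_diff_left[OF L_S[OF assms(1,2)] N_S[OF assms(1,2)] assms(3)], of q] assms(4)
  by (simp add: contor_def cext_cov_at)

text \<open>Pointwise linearity in \<open>V\<close> comes without the Leibniz rule: by \<open>G_tor\<close>, the field \<open>V\<close> enters only
  as a direction of differentiation and as an argument of the metric.\<close>

lemma torsion_expand_left:
  assumes "q \<in> U" "V \<in> S" "X \<in> S" "Y \<in> S"
  shows "cG (tor V X) Y q = (\<Sum>B\<in>I. cG V (E (bar B)) q * cG (tor (E B) X) Y q)"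
proof -
  \<comment> \<open>The right-hand side of \<open>G_tor\<close>, with \<open>contor\<close> split
    into two derivatives, as a function of the value of the first field at \<open>q\<close>.\<close>
  define \<phi> where "\<phi> v = cext_metric g q (cov_at D q v X) (Y q) - cext_metric g q (cov_at DL q v X) (Y q)
    - cext_metric g q v (contor X Y q)" for v
  have "clinear_at q \<phi>"
    using clinear_cov_at[OF g D(1) _ assms(1) S_ctangent[OF assms(4,1)], of X]
      clinear_cov_at[OF g DL(1) _ assms(1) S_ctangent[OF assms(4,1)], of X]
      clinear_metric[OF g U_points[OF assms(1)] S_ctangent[OF contor_S[OF assms(3,4)] assms(1)]] assms(3)
    unfolding clinear_at_def \<phi>_def by (simp add: algebra_simps)
  note * = clinear_frame[OF assms(1) S_ctangent[OF assms(2,1)] this]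
  have \<phi>: "\<phi> (W q) = cG (tor W X) Y q" if "W \<in> S" for W
    using G_tor[OF that assms(3,4)] cG_contor_left[OF that assms(3,4,1)] G_sym[OF contor_S[OF assms(3,4)] that] assms(1)
    by (simp add: \<phi>_def del: cG_at) simp
  have "(\<Sum>B\<in>I. cext_metric g q (V q) (E (bar B) q) * \<phi> (E B q))
      = (\<Sum>B\<in>I. cG V (E (bar B)) q * cG (tor (E B) X) Y q)"
    by (intro sum.cong refl) (simp only: \<phi>[OF E_S] cG_at[OF assms(1)])
  with * show ?thesis by (simp only: \<phi>[OF assms(2)])
qed

section \<open>Components as metric products\<close>

lemma torsion_comp_eq:
  assumes "p \<in> U" "A \<in> I" "B \<in> I" "C \<in> I"
  shows "torsion_comp n M D e p A B C = cG (tor (E A) (E B)) (E (bar C)) p"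
  unfolding torsion_comp_def torsion_at[OF E_S[OF assms(2)] E_S[OF assms(3)] assms(1)] cG_at[OF assms(1)]
  by (rule component_eq[OF assms(1) S_ctangent[OF tor_S assms(1)] assms(4)]) (rule E_S, rule assms)+

lemma cov_torsion_comp_eq:
  assumes "p \<in> U" "A \<in> I" "B \<in> I" "C \<in> I" "F \<in> I"
  shows "cov_torsion_comp n M D e p A B C F = cG (dtor (E C) (E A) (E B)) (E (bar F)) p"
  unfolding cov_torsion_comp_def cG_at[OF assms(1)]
    cov_torsion_at[OF E_S[OF assms(2)] E_S[OF assms(3)] E_S[OF assms(4)] assms(1)]
  by (rule component_eq[OF assms(1) S_ctangent[OF dtor_S assms(1)] assms(5)]) (rule E_S, rule assms)+

lemma curvature_comp_eq:
  assumes "p \<in> U" "A \<in> I" "B \<in> I" "C \<in> I" "F \<in> I"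
  shows "curvature_comp M g D e p A B C F = cG (curv (E C) (E F) (E A)) (E B) p"
    and "curvature_comp M g DL e p A B C F = cG (curvL (E C) (E F) (E A)) (E B) p"
  unfolding curvature_comp_def curvature4_def cG_at[OF assms(1)]
    curvature_at[OF E_S[OF assms(4)] E_S[OF assms(5)] E_S[OF assms(2)] assms(1)] by (rule refl)+

text \<open>All indices of \<open>T\<close> are lowered: \<open>T A B C\<close> is the torsion
  component with upper index \<open>bar C\<close>. The factor 4 clears the two halves that
  \<open>koszul\<close> puts into a product of contorsions.\<close>

lemma levi_civita_curvature_component:
  fixes i j k l p
  defines "T \<equiv> \<lambda>A B C. cG (tor (E A) (E B)) (E C) p"
    and "R \<equiv> \<lambda>A B C F. cG (curv (E C) (E F) (E A)) (E B) p"
  assumes p: "p \<in> U" and ijkl: "i \<in> {1..n}" "j \<in> {1..n}" "k \<in> {1..n}" "l \<in> {1..n}"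
  shows "4 * cG (curvL (E (Hol k)) (E (Bar l)) (E (Hol i))) (E (Hol j)) p =
    2 * (R (Hol k) (Bar l) (Hol i) (Hol j) - R (Hol i) (Bar l) (Hol j) (Hol k) - R (Hol j) (Bar l) (Hol k) (Hol i))
    + 2 * cG (dtor (E (Hol k)) (E (Hol i)) (E (Hol j))) (E (Bar l)) p
    + (\<Sum>m=1..n. - 2 * T (Hol i) (Hol j) (Hol m) * T (Bar l) (Bar m) (Hol k)
        + T (Hol j) (Hol m) (Bar l) * T (Hol i) (Hol k) (Bar m)
        - T (Hol i) (Hol m) (Bar l) * T (Hol j) (Hol k) (Bar m)
        + T (Bar l) (Bar m) (Hol i) * (T (Hol j) (Hol k) (Hol m) - T (Hol k) (Hol m) (Hol j) + T (Hol m) (Hol j) (Hol k))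
        - T (Bar l) (Bar m) (Hol j) * (T (Hol i) (Hol k) (Hol m) - T (Hol k) (Hol m) (Hol i) + T (Hol m) (Hol i) (Hol k)))"
    (is "_ = _ + _ + sum ?H _")
proof -
  have iI: "Hol i \<in> I" "Hol j \<in> I" "Hol k \<in> I" "Bar l \<in> I" using ijkl by simp_all
  note ES = E_S[OF iI(1)] E_S[OF iI(2)] E_S[OF iI(3)] E_S[OF iI(4)]
  have hol: "field_10 (E (Hol a))" and antihol: "field_10 (conj_field (E (Bar a)))" if "a \<in> {1..n}" for a
    using e_10[OF that] by simp_all
  have T0: "T (Hol a) (Bar b) C = 0" "T (Bar b) (Hol a) C = 0" if "a \<in> {1..n}" "b \<in> {1..n}" "C \<in> I" for a b C
    unfolding T_def tor_10_01[OF hol[OF that(1)] antihol[OF that(2)]] tor_01_10[OF antihol[OF that(2)] hol[OF that(1)]]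
      G_zero_left[OF E_S[OF that(3)]] by simp_all
  have T_anti: "T B A C = - T A B C" if "A \<in> I" "B \<in> I" "C \<in> I" for A B C
    unfolding T_def tor_antisym[of "E B" "E A"] G_minus_left[OF tor_S[OF E_S[OF that(1)] E_S[OF that(2)]] E_S[OF that(3)]]
    by (simp only: uminus_apply)
  \<comment> \<open>The inner torsion is expanded in the frame. Only its (0,1)-part gives an unmixed
    outer torsion with \<open>Bar l\<close>, and the coefficient of that part is the pairing with
    \<open>Hol m\<close>.\<close>
  have T_tor: "cG (tor (tor (E (Hol a)) (E (Hol b))) (E (Bar l))) (E (Hol c)) p
      = - (\<Sum>m=1..n. T (Hol a) (Hol b) (Hol m) * T (Bar l) (Bar m) (Hol c))"
    if abc: "a \<in> {1..n}" "b \<in> {1..n}" "c \<in> {1..n}" for a b c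
  proof -
    have "cG (tor (tor (E (Hol a)) (E (Hol b))) (E (Bar l))) (E (Hol c)) p
        = (\<Sum>B\<in>I. T (Hol a) (Hol b) (bar B) * T B (Bar l) (Hol c))"
      unfolding T_def using abc ijkl by (intro torsion_expand_left p tor_S E_S) simp_all
    also have "\<dots> = (\<Sum>m=1..n. T (Hol a) (Hol b) (Bar m) * T (Hol m) (Bar l) (Hol c))
        + (\<Sum>m=1..n. T (Hol a) (Hol b) (Hol m) * T (Bar m) (Bar l) (Hol c))"
      by (simp only: sum_frame_indices bar.simps)
    finally have *: "cG (tor (tor (E (Hol a)) (E (Hol b))) (E (Bar l))) (E (Hol c)) p = \<dots>" .
    have s1: "(\<Sum>m=1..n. T (Hol a) (Hol b) (Bar m) * T (Hol m) (Bar l) (Hol c)) = 0"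
      using T0(1) ijkl abc by (intro sum.neutral ballI) (simp del: atLeastAtMost_iff)
    have s2: "(\<Sum>m=1..n. T (Hol a) (Hol b) (Hol m) * T (Bar m) (Bar l) (Hol c))
        = (\<Sum>m=1..n. - (T (Hol a) (Hol b) (Hol m) * T (Bar l) (Bar m) (Hol c)))"
      using T_anti[of "Bar l" "Bar _" "Hol c"] ijkl abc by (intro sum.cong refl) (simp del: atLeastAtMost_iff)
    show ?thesis unfolding * s1 s2 by (simp add: sum_negf)
  qed
  \<comment> \<open>The first Bianchi identity for types (1,0), (1,0), (0,1), paired with a
    (1,0)-field. Two curvature terms keep type (1,0) and pair to 0, mixed torsions drop out, and
    skewness turns the third curvature term into a component \<open>R\<close>.\<close>
  have dT: "cG (dtor (E (Bar l)) (E (Hol a)) (E (Hol b))) (E (Hol c)) p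
      = - R (Hol c) (Bar l) (Hol a) (Hol b) + (\<Sum>m=1..n. T (Hol a) (Hol b) (Hol m) * T (Bar l) (Bar m) (Hol c))"
    if abc: "a \<in> {1..n}" "b \<in> {1..n}" "c \<in> {1..n}" for a b c
  proof -
    define X where "X = E (Hol a)"
    define Y where "Y = E (Hol b)"
    define Z where "Z = E (Hol c)"
    define W where "W = E (Bar l)"
    have f: "field_10 X" "field_10 Y" "field_10 Z" "field_10 (conj_field W)"
      unfolding X_def Y_def Z_def W_def using abc ijkl by (auto intro: hol antihol simp del: frame_field.simps)
    have S: "X \<in> S" "Y \<in> S" "Z \<in> S" "W \<in> S"
      using field_10_S[OF f(1)] field_10_S[OF f(2)] field_10_S[OF f(3)] E_S[OF iI(4)] by (simp_all only: W_def)
    have tor0: "tor (tor Y W) X = 0" "tor (tor W X) Y = 0"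
      by (simp_all only: tor_10_01[OF f(2,4)] tor_01_10[OF f(4,1)] tor_zero_left[OF S(1)] tor_zero_left[OF S(2)])
    have "curv X Y W + curv Y W X + curv W X Y = dtor W X Y + tor (tor X Y) W"
      using first_bianchi[OF S(1,2,4)] tor0 dtor_10_01[OF S(1) f(2,4)] dtor_10_01[OF S(2) f(1,4)] by simp
    then have "cG (curv X Y W + curv Y W X + curv W X Y) Z p = cG (dtor W X Y + tor (tor X Y) W) Z p"
      by (simp only:)
    then have "cG (curv X Y W) Z p + cG (curv Y W X) Z p + cG (curv W X Y) Z p
        = cG (dtor W X Y) Z p + cG (tor (tor X Y) W) Z p"
      by (simp only: G_add_left S_add curv_S dtor_S tor_S S plus_fun_apply)
    moreover have "cG (curv Y W X) Z = 0" "cG (curv W X Y) Z = 0"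
      by (rule G_curv_10[OF S(2,4) f(1,3)] G_curv_10[OF S(4,1) f(2,3)])+
    moreover have "cG (curv X Y W) Z p = - R (Hol c) (Bar l) (Hol a) (Hol b)"
      using fun_cong[OF curv_skew[OF S(1,2,4,3)], of p] unfolding R_def X_def Y_def Z_def W_def by (simp only: uminus_apply)
    moreover have "cG (tor (tor X Y) W) Z p = - (\<Sum>m=1..n. T (Hol a) (Hol b) (Hol m) * T (Bar l) (Bar m) (Hol c))"
      using T_tor[OF abc] by (simp only: X_def Y_def Z_def W_def)
    ultimately show ?thesis by (simp add: X_def Y_def Z_def W_def del: cG_at frame_field.simps)
  qed
  have koszul_T: "2 * cG (contor (E A) (E B)) (E C) p = T B C A - T A B C - T C A B" if "A \<in> I" "B \<in> I" "C \<in> I" for A B C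
    using fun_cong[OF koszul[OF E_S[OF that(1)] E_S[OF that(2)] E_S[OF that(3)]], of p] 
    by (simp only: T_def plus_fun_apply minus_apply mult_2)
  \<comment> \<open>Parseval with both factors given by \<open>koszul_T\<close>. In direction
    \<open>Bar l\<close> the vanishing of mixed torsion leaves a single term; the other factor keeps
    three terms against \<open>Hol m\<close> and one against \<open>Bar m\<close>.\<close>
  have quad: "4 * cG (contor (E (Bar l)) (E (Hol a))) (contor (E (Hol k)) (E (Hol b))) p
      = (\<Sum>m=1..n. T (Bar l) (Bar m) (Hol a) * (T (Hol b) (Hol m) (Hol k) - T (Hol k) (Hol b) (Hol m) - T (Hol m) (Hol k) (Hol b))
          - T (Hol a) (Hol m) (Bar l) * T (Hol k) (Hol b) (Bar m))"
    if ab: "a \<in> {1..n}" "b \<in> {1..n}" for a b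
  proof -
    have abI: "Hol a \<in> I" "Hol b \<in> I" using ab by simp_all
    have 1: "2 * cG (contor (E (Bar l)) (E (Hol a))) (E (Hol m)) p = T (Hol a) (Hol m) (Bar l)"
      "2 * cG (contor (E (Bar l)) (E (Hol a))) (E (Bar m)) p = T (Bar l) (Bar m) (Hol a)"
      "2 * cG (contor (E (Hol k)) (E (Hol b))) (E (Bar m)) p = - T (Hol k) (Hol b) (Bar m)"
      if m: "m \<in> {1..n}" for m
    proof -
      have mI: "Hol m \<in> I" "Bar m \<in> I" using m by simp_all
      show "2 * cG (contor (E (Bar l)) (E (Hol a))) (E (Hol m)) p = T (Hol a) (Hol m) (Bar l)"
        using koszul_T[OF iI(4) abI(1) mI(1)] T0(2)[OF ab(1) ijkl(4) mI(1)] T0(1)[OF m ijkl(4) abI(1)] by simp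
      show "2 * cG (contor (E (Bar l)) (E (Hol a))) (E (Bar m)) p = T (Bar l) (Bar m) (Hol a)"
        using koszul_T[OF iI(4) abI(1) mI(2)] T0(1)[OF ab(1) m iI(4)] T0(2)[OF ab(1) ijkl(4) mI(2)]
          T_anti[OF iI(4) mI(2) abI(1)] by simp
      show "2 * cG (contor (E (Hol k)) (E (Hol b))) (E (Bar m)) p = - T (Hol k) (Hol b) (Bar m)"
        using koszul_T[OF iI(3) abI(2) mI(2)] T0(1)[OF ab(2) m iI(3)] T0(2)[OF ijkl(3) m abI(2)] by simp
    qed
    have 2: "2 * cG (contor (E (Hol k)) (E (Hol b))) (E (Hol m)) p
        = T (Hol b) (Hol m) (Hol k) - T (Hol k) (Hol b) (Hol m) - T (Hol m) (Hol k) (Hol b)" if "m \<in> {1..n}" for m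
      using koszul_T[OF iI(3) abI(2), of "Hol m"] that by simp
    have "4 * cG (contor (E (Bar l)) (E (Hol a))) (contor (E (Hol k)) (E (Hol b))) p
      = (\<Sum>B\<in>I. (2 * cG (contor (E (Bar l)) (E (Hol a))) (E (bar B)) p) * (2 * cG (contor (E (Hol k)) (E (Hol b))) (E B) p))"
      unfolding parseval[OF p contor_S[OF E_S[OF iI(4)] E_S[OF abI(1)]] contor_S[OF E_S[OF iI(3)] E_S[OF abI(2)]]]
        sum_distrib_left by (intro sum.cong refl) (simp only: mult.assoc mult.left_commute, simp)
    also have "\<dots> = (\<Sum>m=1..n. T (Bar l) (Bar m) (Hol a) * (T (Hol b) (Hol m) (Hol k) - T (Hol k) (Hol b) (Hol m) - T (Hol m) (Hol k) (Hol b)))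
      + (\<Sum>m=1..n. T (Hol a) (Hol m) (Bar l) * (- T (Hol k) (Hol b) (Bar m)))"
      unfolding sum_frame_indices bar.simps
      by (intro arg_cong2[where f = "(+)"] sum.cong refl) (simp_all only: 1 2)
    finally show ?thesis by (simp add: sum.distrib sum_subtractf sum_negf)
  qed
  have "tor (E (Hol k)) (E (Bar l)) = 0" by (rule tor_10_01[OF hol[OF ijkl(3)] antihol[OF ijkl(4)]])
  then have contor0: "cG (contor (tor (E (Hol k)) (E (Bar l))) (E (Hol i))) (E (Hol j)) = 0"
    using ES by (simp only: contor_def N_zero_left L_zero_left G_zero_left diff_self)
  have RL: "cG (curvL (E (Hol k)) (E (Bar l)) (E (Hol i))) (E (Hol j)) p
    = cG (dcontor (E (Hol k)) (E (Bar l)) (E (Hol i))) (E (Hol j)) p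
      - cG (dcontor (E (Bar l)) (E (Hol k)) (E (Hol i))) (E (Hol j)) p
      - cG (contor (E (Bar l)) (E (Hol i))) (contor (E (Hol k)) (E (Hol j))) p
      + cG (contor (E (Hol k)) (E (Hol i))) (contor (E (Bar l)) (E (Hol j))) p"
    using fun_cong[OF curvature_difference[OF ES], of p]
    by (simp only: contor0 G_curv_10[OF ES(3,4) hol[OF ijkl(1)] hol[OF ijkl(2)]] plus_fun_apply minus_apply zero_fun_apply add_0 add_0_right)
  have sym: "cG (contor (E (Hol k)) (E (Hol i))) (contor (E (Bar l)) (E (Hol j))) = cG (contor (E (Bar l)) (E (Hol j))) (contor (E (Hol k)) (E (Hol i)))"
    by (rule G_sym[OF contor_S[OF ES(3,1)] contor_S[OF ES(4,2)]])
  \<comment> \<open>In direction \<open>Hol k\<close> two of the three derivatives are of mixed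
    torsions and vanish. In \<open>d2\<close> all three remain, and \<open>dT\<close> evaluates
    each.\<close>
  have d1: "2 * cG (dcontor (E (Hol k)) (E (Bar l)) (E (Hol i))) (E (Hol j)) p
      = cG (dtor (E (Hol k)) (E (Hol i)) (E (Hol j))) (E (Bar l)) p"
    using fun_cong[OF d_koszul[OF ES], of p]
    unfolding dtor_10_01[OF ES(3) hol[OF ijkl(1)] antihol[OF ijkl(4)]] dtor_10_01[OF ES(3) hol[OF ijkl(2)] antihol[OF ijkl(4)]]
      G_zero_left[OF ES(1)] G_zero_left[OF ES(2)] plus_fun_apply minus_apply zero_fun_apply mult_2 by simp
  have d2: "2 * cG (dcontor (E (Bar l)) (E (Hol k)) (E (Hol i))) (E (Hol j)) p
      = cG (dtor (E (Bar l)) (E (Hol i)) (E (Hol j))) (E (Hol k)) p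
      - cG (dtor (E (Bar l)) (E (Hol k)) (E (Hol i))) (E (Hol j)) p
      - cG (dtor (E (Bar l)) (E (Hol j)) (E (Hol k))) (E (Hol i)) p"
    using fun_cong[OF d_koszul[OF ES(1,2,4,3)], of p] by (simp only: plus_fun_apply minus_apply mult_2)
  \<comment> \<open>The quadratic terms as they arise: the three with factor 2 from the Bianchi
    identity, the others from the commutator of A.\<close>
  define F where "F m = - 2 * (T (Hol i) (Hol j) (Hol m) * T (Bar l) (Bar m) (Hol k))
        + 2 * (T (Hol k) (Hol i) (Hol m) * T (Bar l) (Bar m) (Hol j))
        + 2 * (T (Hol j) (Hol k) (Hol m) * T (Bar l) (Bar m) (Hol i))
        - (T (Bar l) (Bar m) (Hol i) * (T (Hol j) (Hol m) (Hol k) - T (Hol k) (Hol j) (Hol m) - T (Hol m) (Hol k) (Hol j))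
          - T (Hol i) (Hol m) (Bar l) * T (Hol k) (Hol j) (Bar m))
        + (T (Bar l) (Bar m) (Hol j) * (T (Hol i) (Hol m) (Hol k) - T (Hol k) (Hol i) (Hol m) - T (Hol m) (Hol k) (Hol i))
          - T (Hol j) (Hol m) (Bar l) * T (Hol k) (Hol i) (Bar m))" for m
  have "4 * cG (curvL (E (Hol k)) (E (Bar l)) (E (Hol i))) (E (Hol j)) p
    = 2 * (2 * cG (dcontor (E (Hol k)) (E (Bar l)) (E (Hol i))) (E (Hol j)) p)
      - 2 * (2 * cG (dcontor (E (Bar l)) (E (Hol k)) (E (Hol i))) (E (Hol j)) p)
      - 4 * cG (contor (E (Bar l)) (E (Hol i))) (contor (E (Hol k)) (E (Hol j))) p
      + 4 * cG (contor (E (Bar l)) (E (Hol j))) (contor (E (Hol k)) (E (Hol i))) p"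
    unfolding RL sym by (simp only: ring_distribs) simp
  also have "\<dots> = 2 * (R (Hol k) (Bar l) (Hol i) (Hol j) - R (Hol i) (Bar l) (Hol j) (Hol k) - R (Hol j) (Bar l) (Hol k) (Hol i))
    + 2 * cG (dtor (E (Hol k)) (E (Hol i)) (E (Hol j))) (E (Bar l)) p
    + (\<Sum>m=1..n. F m)"
    unfolding d1 d2 quad[OF ijkl(1,2)] quad[OF ijkl(2,1)] dT[OF ijkl(1,2,3)] dT[OF ijkl(3,1,2)] dT[OF ijkl(2,3,1)] F_def
    by (simp only: sum.distrib sum_subtractf sum_negf sum_distrib_left[symmetric] ring_distribs) (simp add: algebra_simps)
  finally have eq: "4 * cG (curvL (E (Hol k)) (E (Bar l)) (E (Hol i))) (E (Hol j)) p = \<dots>" .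
  \<comment> \<open>Antisymmetry in the first two indices gives the stated form. For instance,
    \<open>T (Hol j) (Hol k) (Hol m)\<close> next to \<open>T (Bar l) (Bar m) (Hol i)\<close> has
    coefficient 2 from Bianchi minus 1 from the commutator.\<close>
  have "sum F {1..n} = sum ?H {1..n}"
  proof (intro sum.cong refl)
    fix m assume "m \<in> {1..n}"
    then have m: "Hol m \<in> I" "Bar m \<in> I" by simp_all
    note anti = T_anti[OF iI(1) iI(3) m(1)] T_anti[OF iI(2) iI(3) m(1)] T_anti[OF iI(1) iI(3) m(2)] T_anti[OF iI(2) iI(3) m(2)]
      T_anti[OF iI(3) m(1) iI(1)] T_anti[OF iI(3) m(1) iI(2)] T_anti[OF m(1) iI(1) iI(3)] T_anti[OF m(1) iI(2) iI(3)]
    show "F m = ?H m"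
      unfolding F_def anti by (simp add: algebra_simps)
  qed
  then show ?thesis by (simp only: eq)
qed

end

theorem theorem3p2:
  fixes M :: "('a::{t2_space, second_countable_topology}, 'e::euclidean_space) atlas"
    and J :: "'a \<Rightarrow> ('a, real) tvec \<Rightarrow> ('a, real) tvec"
    and g :: "'a \<Rightarrow> ('a, real) tvec \<Rightarrow> ('a, real) tvec \<Rightarrow> real"
    and D DL :: "'a connection"
    and e :: "nat \<Rightarrow> ('a, complex) vfield"
    and U :: "'a set"
    and n i j k l :: nat
    and p :: 'a
  assumes "almost_hermitian_manifold n M J g"
    and "canonical_connection M J g D"
    and "levi_civita_connection M g DL"
    and "unitary_10_frame n M J g U e"
    and "p \<in> U"
    and "i \<in> {1..n}" and "j \<in> {1..n}" and "k \<in> {1..n}" and "l \<in> {1..n}"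
  shows "let RL = curvature_comp M g DL e p;
             R = curvature_comp M g D e p;
             \<tau> = torsion_comp n M D e p;
             d\<tau> = cov_torsion_comp n M D e p
    in RL (Hol i) (Hol j) (Hol k) (Bar l) =
        1/2 * (R (Hol k) (Bar l) (Hol i) (Hol j) - R (Hol i) (Bar l) (Hol j) (Hol k)
             - R (Hol j) (Bar l) (Hol k) (Hol i))
      + 1/2 * (d\<tau> (Hol i) (Hol j) (Hol k) (Hol l)
             - (\<Sum>m=1..n. \<tau> (Hol i) (Hol j) (Bar m) * \<tau> (Bar l) (Bar m) (Bar k)))
      + 1/4 * ((\<Sum>m=1..n. \<tau> (Hol j) (Hol m) (Hol l) * \<tau> (Hol i) (Hol k) (Hol m))
             - (\<Sum>m=1..n. \<tau> (Hol i) (Hol m) (Hol l) * \<tau> (Hol j) (Hol k) (Hol m)))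
      + 1/4 * (\<Sum>m=1..n. \<tau> (Bar l) (Bar m) (Bar i) *
               (\<tau> (Hol j) (Hol k) (Bar m) - \<tau> (Hol k) (Hol m) (Bar j) + \<tau> (Hol m) (Hol j) (Bar k)))
      - 1/4 * (\<Sum>m=1..n. \<tau> (Bar l) (Bar m) (Bar j) *
               (\<tau> (Hol i) (Hol k) (Bar m) - \<tau> (Hol k) (Hol m) (Bar i) + \<tau> (Hol m) (Hol i) (Bar k)))"
proof -
  interpret hermitian_frame n M J g D DL e U
    using assms(1-4) by (rule hermitian_frame.intro)
  define T where "T A B C = cG (tor (E A) (E B)) (E C) p" for A B C
  define R where "R A B C F = cG (curv (E C) (E F) (E A)) (E B) p" for A B C F
  \<comment> \<open>The coefficient of a frame vector is the pairing with its dual, so lowering an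
    upper index conjugates it.\<close>
  have \<tau>: "torsion_comp n M D e p A B C = T A B (bar C)" if "A \<in> I" "B \<in> I" "C \<in> I" for A B C
    unfolding T_def by (rule torsion_comp_eq[OF \<open>p \<in> U\<close> that])
  have R: "curvature_comp M g D e p A B C F = R A B C F" if "A \<in> I" "B \<in> I" "C \<in> I" "F \<in> I" for A B C F
    unfolding R_def by (rule curvature_comp_eq(1)[OF \<open>p \<in> U\<close> that])
  have iI: "Hol i \<in> I" "Hol j \<in> I" "Hol k \<in> I" "Bar l \<in> I" "Hol l \<in> I" "Bar i \<in> I" "Bar j \<in> I" "Bar k \<in> I"
    using assms(6-9) by simp_all
  have mI: "Hol m \<in> I" "Bar m \<in> I" if "m \<in> {1..n}" for m
    using that by simp_all
  note d\<tau> = cov_torsion_comp_eq[OF \<open>p \<in> U\<close> iI(1,2,3,5), unfolded bar.simps]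
  note RL = curvature_comp_eq(2)[OF \<open>p \<in> U\<close> iI(1,2,3,4)]
  have main: "4 * curvature_comp M g DL e p (Hol i) (Hol j) (Hol k) (Bar l) =
    2 * (R (Hol k) (Bar l) (Hol i) (Hol j) - R (Hol i) (Bar l) (Hol j) (Hol k) - R (Hol j) (Bar l) (Hol k) (Hol i))
    + 2 * cov_torsion_comp n M D e p (Hol i) (Hol j) (Hol k) (Hol l)
    + (\<Sum>m=1..n. - 2 * T (Hol i) (Hol j) (Hol m) * T (Bar l) (Bar m) (Hol k)
        + T (Hol j) (Hol m) (Bar l) * T (Hol i) (Hol k) (Bar m)
        - T (Hol i) (Hol m) (Bar l) * T (Hol j) (Hol k) (Bar m)
        + T (Bar l) (Bar m) (Hol i) * (T (Hol j) (Hol k) (Hol m) - T (Hol k) (Hol m) (Hol j) + T (Hol m) (Hol j) (Hol k))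
        - T (Bar l) (Bar m) (Hol j) * (T (Hol i) (Hol k) (Hol m) - T (Hol k) (Hol m) (Hol i) + T (Hol m) (Hol i) (Hol k)))"
    using levi_civita_curvature_component[OF \<open>p \<in> U\<close> assms(6-9)]
    unfolding RL d\<tau> T_def[symmetric] R_def[symmetric] .
  have sums: "(\<Sum>m=1..n. torsion_comp n M D e p (Hol i) (Hol j) (Bar m) * torsion_comp n M D e p (Bar l) (Bar m) (Bar k))
      = (\<Sum>m=1..n. T (Hol i) (Hol j) (Hol m) * T (Bar l) (Bar m) (Hol k))"
    "(\<Sum>m=1..n. torsion_comp n M D e p (Hol a) (Hol m) (Hol l) * torsion_comp n M D e p (Hol b) (Hol k) (Hol m))
      = (\<Sum>m=1..n. T (Hol a) (Hol m) (Bar l) * T (Hol b) (Hol k) (Bar m))"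
    "(\<Sum>m=1..n. torsion_comp n M D e p (Bar l) (Bar m) (Bar a) *
        (torsion_comp n M D e p (Hol b) (Hol k) (Bar m) - torsion_comp n M D e p (Hol k) (Hol m) (Bar b)
          + torsion_comp n M D e p (Hol m) (Hol b) (Bar k)))
      = (\<Sum>m=1..n. T (Bar l) (Bar m) (Hol a) * (T (Hol b) (Hol k) (Hol m) - T (Hol k) (Hol m) (Hol b) + T (Hol m) (Hol b) (Hol k)))"
    if "a \<in> {1..n}" "b \<in> {1..n}" for a b
    by (intro sum.cong refl; simp only: \<tau> iI mI that bar.simps)+
  \<comment> \<open>Passing to four times the claim removes the fractions before the sums are
    compared.\<close>
  have cancel: "x = y" if "4 * x = 4 * y" for x y :: complex
    using that by simp
  show ?thesis
    unfolding Let_def R[OF iI(3,4,1,2)] R[OF iI(1,4,2,3)] R[OF iI(2,4,3,1)] sums(1)[OF assms(6,7)]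
      sums(2)[OF assms(6,7)] sums(2)[OF assms(7,6)] sums(3)[OF assms(6,7)] sums(3)[OF assms(7,6)]
    by (rule cancel, unfold main)
      (simp only: sum.distrib sum_subtractf sum_distrib_left[symmetric] mult.assoc, simp add: algebra_simps)
qed

end
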